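(* For $\delta\ge 0$ consider the copositive program $$(\mathrm{CP}_\delta)\qquad \begin{array}{ll} \text{minimize} & \displaystyle c^\top x+\epsilon^2\lambda+\frac1I\sum_{i\in[I]}\Big[s_i+\mathfrak q^\top\psi_i-\lambda\|\hat\xi_i\|_2^2+\sum_{j\in[N_2+J]}\phi_{ij}\mathfrak q_j^2\Big]\\ \text{subject to} & x\in\mathcal X,\ \lambda\in\mathbb R_+,\ s_i\in\mathbb R,\ \psi_i,\phi_i\in\mathbb R^{N_2+J}\quad\forall i\in[I],\\ & \mathcal M_i^\delta(x,\lambda,s_i,\psi_i,\phi_i)\succeq_{\mathcal C}0\quad\forall i\in[I], \end{array}$$ where $$\mathcal M_i^\delta(x,\lambda,s_i,\psi_i,\phi_i)=\begin{bmatrix}\lambda\mathbb I+\mathcal Q^\top\mathrm{diag}(\phi_i)\mathcal Q & -\frac12\mathcal T(x)^\top-\mathcal Q^\top\mathrm{diag}(\phi_i)\mathcal W^\top & -\lambda\hat\xi_i-\frac12\mathcal Q^\top\psi_i\\ -\frac12\mathcal T(x)-\mathcal W\mathrm{diag}(\phi_i)\mathcal Q & \mathcal W\mathrm{diag}(\phi_i)\mathcal W^\top+\delta\mathbb I & \frac12(\mathcal W\psi_i-\mathfrak h(x))\\ (-\lambda\hat\xi_i-\frac12\mathcal Q^\top\psi_i)^\top & \frac12(\mathcal W\psi_i-\mathfrak h(x))^\top & s_i\end{bmatrix}.$$ Let (DRO) denote the problem of minimizing $c^\top x+\mathcal Z(x)$ over $x\in\mathcal X$. Then the following statements hold. (i)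 If $\delta=0$ and (DRO) has complete recourse, then $(\mathrm{CP}_\delta)$ is equivalent to (DRO). (ii) If $\delta=0$ and (DRO) fails to have complete recourse, then $(\mathrm{CP}_\delta)$ provides an upper bound on (DRO). (iii) If $\delta>0$, then $(\mathrm{CP}_\delta)$ provides a lower bound on (DRO). (iv) If $\mathcal X$ is compact, then the optimal value of $(\mathrm{CP}_\delta)$ converges to that of (DRO) as $\delta\downarrow0$. Moreover, every cluster point $x^\star$ of a sequence $\{x^\star_\delta\}_{\delta\downarrow 0}$ of minimizers for $(\mathrm{CP}_\delta)$ is a minimizer for (DRO).
   Context: Notation: $[n]=\{1,\dots,n\}$; $\mathbb I$ is an identity matrix; $\mathcal C$ is the cone of copositive matrices (symmetric $A$ with $\xi^\top A\xi\ge0$ for all $\xi\ge0$), and $A\succeq_{\mathcal C}0$ means $A\in\mathcal C$ (in the appropriate dimension). Problem data: $c\in\mathbb R^{N_1}$, $\mathcal X\subseteq\mathbb R^{N_1}$, $Q\in\mathbb R^{N_2\times K}$, $q\in\mathbb R^{N_2}$, $W\in\mathbb R^{M\times N_2}$, and affine functions $T:\mathbb R^{N_1}\to\mathbb R^{M\times K}$, $h:\mathbb R^{N_1}\to\mathbb R^M$. The support set is a nonempty (possibly unbounded) polyhedron $\Xi=\{\xi\in\mathbb R_+^K: S\xi\le t\}$ with $S\in\mathbb R^{J\times K}$, $t\in\mathbb R^J$. The recourse function is $$Z(x,\xi)=\inf\{(Q\xi+q)^\top y:\ y\in\mathbb R^{N_2},\ T(x)\xi+h(x)\le Wy\}.$$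 Given samples $\hat\xi_1,\dots,\hat\xi_I\in\Xi$, let $\hat{\mathbb P}_I=\frac1I\sum_{i\in[I]}\delta_{\hat\xi_i}$. The 2-Wasserstein distance of distributions $\mathbb P_1,\mathbb P_2$ on $\Xi$ with finite second moments is $W^2(\mathbb P_1,\mathbb P_2)=\inf_{\mathbb Q}\big(\int_{\Xi^2}\|\xi_1-\xi_2\|_2^2\,\mathbb Q(d\xi_1,d\xi_2)\big)^{1/2}$, the infimum being over couplings $\mathbb Q$ of $\mathbb P_1,\mathbb P_2$. For a radius $\epsilon\ge0$, $\mathcal B_\epsilon^2(\hat{\mathbb P}_I)$ is the set of distributions on $\Xi$ with finite second moments and $W^2(\mathbb P,\hat{\mathbb P}_I)\le\epsilon$. The worst-case expected wait-and-see cost is $\mathcal Z(x)=\sup_{\mathbb P\in\mathcal B_\epsilon^2(\hat{\mathbb P}_I)}\mathbb E_{\mathbb P}[Z(x,\tilde\xi)]$. Complete recourse: there exists $y^+\in\mathbb R^{N_2}$ with $Wy^+>0$ componentwise. Sufficiently expensive recourse (standing assumption): for every $\xi\in\Xi$ there exists $p\in\mathbb R_+^M$ with $Q\xi+q=W^\top p$. Extended parameters: $$\mathcal Q=\begin{bmatrix}Q\\S\end{bmatrix},\quad \mathfrak q=\begin{bmatrix}q\\-t\end{bmatrix},\quad\mathcal T(x)=\begin{bmatrix}T(x)\\0\end{bmatrix},\quad\mathfrak h(x)=\begin{bmatrix}h(x)\\0\end{bmatrix},\quad\mathcal W=\begin{bmatrix}W&0\\0&-\mathbb I\end{bmatrix},$$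 with $\mathcal Q\in\mathbb R^{(N_2+J)\times K}$, $\mathfrak q\in\mathbb R^{N_2+J}$, $\mathcal T(x)\in\mathbb R^{(M+J)\times K}$, $\mathfrak h(x)\in\mathbb R^{M+J}$, $\mathcal W\in\mathbb R^{(M+J)\times(N_2+J)}$. Conventions: optimal values lie in $[-\infty,\infty]$. "Equivalent" means that for every $x\in\mathcal X$ the infimum of the objective of $(\mathrm{CP}_\delta)$ over all variables other than $x$ equals $c^\top x+\mathcal Z(x)$ (so the optimal values coincide). "Upper (lower) bound" refers to the optimal values. A minimizer for $(\mathrm{CP}_\delta)$ in (iv) means a point $x_\delta^\star\in\mathcal X$ minimizing over $\mathcal X$ the function of $x$ obtained from the objective of $(\mathrm{CP}_\delta)$ by taking the infimum over all other variables. *)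

theory Defs
  imports "HOL-Probability.Probability"
begin

section \<open>Block matrices and copositivity\<close>

text \<open>
  Matrices are vectors of rows, so \<open>stack\<close> serves both to concatenate two vectors and to
  place one matrix on top of another.
\<close>

definition stack :: "'c ^ 'a \<Rightarrow> 'c ^ 'b \<Rightarrow> 'c ^ ('a + 'b)" where
  "stack u v = (\<chi> i. case i of Inl a \<Rightarrow> u $ a | Inr b \<Rightarrow> v $ b)"

definition beside ::
  "'c ^ 'a ^ 'r \<Rightarrow> 'c ^ 'b ^ 'r \<Rightarrow> 'c ^ ('a + 'b) ^ 'r" where
  "beside A B = (\<chi> i. stack (A $ i) (B $ i))"

definition diag :: "real ^ 'n \<Rightarrow> real ^ 'n ^ 'n" where
  "diag v = (\<chi> i j. if i = j then v $ i else 0)"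

definition copositive :: "real ^ 'n ^ 'n \<Rightarrow> bool" where
  "copositive A \<longleftrightarrow> transpose A = A \<and> (\<forall>\<xi>. 0 \<le> \<xi> \<longrightarrow> 0 \<le> \<xi> \<bullet> (A *v \<xi>))"

definition affine_map :: "('a::real_vector \<Rightarrow> 'b::real_vector) \<Rightarrow> bool" where
  "affine_map f \<longleftrightarrow> (\<exists>L b. linear L \<and> f = (\<lambda>x. L x + b))"


section \<open>Distributions, extended expectation and the 2-Wasserstein distance\<close>

text \<open>
  The difference of the expectations of the positive and the negative part. It is the usual
  expectation in \<open>[-\<infinity>, \<infinity>]\<close> as soon as one of the two is finite.
\<close>

definition ext_expectation ::
  "'a measure \<Rightarrow> ('a \<Rightarrow> ereal) \<Rightarrow> ereal" where
  "ext_expectation P f =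
     enn2ereal (\<integral>\<^sup>+ \<xi>. e2ennreal (f \<xi>) \<partial>P) - enn2ereal (\<integral>\<^sup>+ \<xi>. e2ennreal (- f \<xi>) \<partial>P)"

definition distributions2 :: "'a::euclidean_space set \<Rightarrow> 'a measure set" where
  "distributions2 \<Xi> = {P. prob_space P \<and> sets P = sets (restrict_space borel \<Xi>) \<and>
     integrable P (\<lambda>\<xi>. (norm \<xi>)\<^sup>2)}"

definition couplings ::
  "'a measure \<Rightarrow> 'b measure \<Rightarrow> ('a \<times> 'b) measure set" where
  "couplings P1 P2 = {R. prob_space R \<and> sets R = sets (P1 \<Otimes>\<^sub>M P2) \<and>
     distr R P1 fst = P1 \<and> distr R P2 snd = P2}"

text \<open>
  A real infimum is adequate on \<open>distributions2 \<Xi>\<close>: the product measure is a coupling, and the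
  squared distance is integrable with respect to every coupling.
\<close>

definition wasserstein2 ::
  "'a::euclidean_space measure \<Rightarrow> 'a measure \<Rightarrow> real" where
  "wasserstein2 P1 P2 =
     (INF R\<in>couplings P1 P2. sqrt (\<integral>(\<xi>1, \<xi>2). (norm (\<xi>1 - \<xi>2))\<^sup>2 \<partial>R))"


section \<open>The distributionally robust problem\<close>

record ('n1::finite, 'n2::finite, 'm::finite, 'k::finite, 'j::finite) dro_data =
  cost :: "real ^ 'n1"
  decisions :: "(real ^ 'n1) set"
  Qmat :: "real ^ 'k ^ 'n2"
  qvec :: "real ^ 'n2"
  Wmat :: "real ^ 'n2 ^ 'm"
  Tmap :: "real ^ 'n1 \<Rightarrow> real ^ 'k ^ 'm"
  hmap :: "real ^ 'n1 \<Rightarrow> real ^ 'm"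
  Smat :: "real ^ 'k ^ 'j"
  tvec :: "real ^ 'j"
  nsamples :: nat
  sample :: "nat \<Rightarrow> real ^ 'k"
  radius :: real

definition support ::
  "('n1::finite, 'n2::finite, 'm::finite, 'k::finite, 'j::finite) dro_data
     \<Rightarrow> (real ^ 'k) set" where
  "support D = {\<xi>. 0 \<le> \<xi> \<and> Smat D *v \<xi> \<le> tvec D}"

definition recourse ::
  "('n1::finite, 'n2::finite, 'm::finite, 'k::finite, 'j::finite) dro_data
     \<Rightarrow> real ^ 'n1 \<Rightarrow> real ^ 'k \<Rightarrow> ereal" where
  "recourse D x \<xi> = Inf {ereal ((Qmat D *v \<xi> + qvec D) \<bullet> y) | y.
     Tmap D x *v \<xi> + hmap D x \<le> Wmat D *v y}"

text \<open>The strict order on vectors is not componentwise, hence the explicit quantifier.\<close>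

definition complete_recourse ::
  "('n1::finite, 'n2::finite, 'm::finite, 'k::finite, 'j::finite) dro_data
     \<Rightarrow> bool" where
  "complete_recourse D \<longleftrightarrow> (\<exists>y. \<forall>i. 0 < (Wmat D *v y) $ i)"

definition sufficiently_expensive_recourse ::
  "('n1::finite, 'n2::finite, 'm::finite, 'k::finite, 'j::finite) dro_data
     \<Rightarrow> bool" where
  "sufficiently_expensive_recourse D \<longleftrightarrow>
     (\<forall>\<xi>\<in>support D. \<exists>p\<ge>0. Qmat D *v \<xi> + qvec D = transpose (Wmat D) *v p)"

definition empirical ::
  "('n1::finite, 'n2::finite, 'm::finite, 'k::finite, 'j::finite) dro_data
     \<Rightarrow> (real ^ 'k) measure" where
  "empirical D = distr (uniform_count_measure {1..nsamples D})
     (restrict_space borel (support D)) (sample D)"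

lemma emeasure_empirical:
  assumes "\<forall>i\<in>{1..nsamples D}. sample D i \<in> support D" and "1 \<le> nsamples D"
    and A: "A \<in> sets (restrict_space borel (support D))"
  shows "emeasure (empirical D) A =
    ennreal ((1 / real (nsamples D)) * (\<Sum>i\<in>{1..nsamples D}. indicator A (sample D i)))"
proof -
  have m: "sample D \<in> uniform_count_measure {1..nsamples D} \<rightarrow>\<^sub>M restrict_space borel (support D)"
    using assms(1) by (auto simp: measurable_def space_restrict_space sets_uniform_count_measure
        space_uniform_count_measure)
  have "(\<Sum>i\<in>{1..nsamples D}. indicator A (sample D i) :: real)
      = real (card (sample D -` A \<inter> {1..nsamples D}))"
    by (simp add: indicator_def sum.If_cases vimage_def Int_commute)
  then show ?thesis
    unfolding empirical_def
    using assms(2) A m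
    by (simp add: emeasure_distr emeasure_uniform_count_measure space_uniform_count_measure
        ennreal_of_nat_eq_real_of_nat divide_ennreal)
qed

definition ambiguity_set ::
  "('n1::finite, 'n2::finite, 'm::finite, 'k::finite, 'j::finite) dro_data
     \<Rightarrow> (real ^ 'k) measure set" where
  "ambiguity_set D = {P \<in> distributions2 (support D). wasserstein2 P (empirical D) \<le> radius D}"

definition worst_case ::
  "('n1::finite, 'n2::finite, 'm::finite, 'k::finite, 'j::finite) dro_data
     \<Rightarrow> real ^ 'n1 \<Rightarrow> ereal" where
  "worst_case D x = (SUP P\<in>ambiguity_set D. ext_expectation P (recourse D x))"

definition dro_objective ::
  "('n1::finite, 'n2::finite, 'm::finite, 'k::finite, 'j::finite) dro_data
     \<Rightarrow> real ^ 'n1 \<Rightarrow> ereal" where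
  "dro_objective D x = ereal (cost D \<bullet> x) + worst_case D x"

definition dro_value ::
  "('n1::finite, 'n2::finite, 'm::finite, 'k::finite, 'j::finite) dro_data
     \<Rightarrow> ereal" where
  "dro_value D = (INF x\<in>decisions D. dro_objective D x)"


section \<open>The copositive program\<close>

definition extQ ::
  "('n1::finite, 'n2::finite, 'm::finite, 'k::finite, 'j::finite) dro_data
     \<Rightarrow> real ^ 'k ^ ('n2 + 'j)" where
  "extQ D = stack (Qmat D) (Smat D)"

definition extq ::
  "('n1::finite, 'n2::finite, 'm::finite, 'k::finite, 'j::finite) dro_data
     \<Rightarrow> real ^ ('n2 + 'j)" where
  "extq D = stack (qvec D) (- tvec D)"

definition extT ::
  "('n1::finite, 'n2::finite, 'm::finite, 'k::finite, 'j::finite) dro_data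
     \<Rightarrow> real ^ 'n1 \<Rightarrow> real ^ 'k ^ ('m + 'j)" where
  "extT D x = stack (Tmap D x) 0"

definition exth ::
  "('n1::finite, 'n2::finite, 'm::finite, 'k::finite, 'j::finite) dro_data
     \<Rightarrow> real ^ 'n1 \<Rightarrow> real ^ ('m + 'j)" where
  "exth D x = stack (hmap D x) 0"

definition extW ::
  "('n1::finite, 'n2::finite, 'm::finite, 'k::finite, 'j::finite) dro_data
     \<Rightarrow> real ^ ('n2 + 'j) ^ ('m + 'j)" where
  "extW D = stack (beside (Wmat D) 0) (beside 0 (- mat 1))"

text \<open>The matrix with block rows and columns of sizes \<open>K\<close>, \<open>M + J\<close> and \<open>1\<close>.\<close>

definition cp_matrix ::
  "('n1::finite, 'n2::finite, 'm::finite, 'k::finite, 'j::finite) dro_data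
     \<Rightarrow> real \<Rightarrow> nat \<Rightarrow> real ^ 'n1 \<Rightarrow> real \<Rightarrow> real
     \<Rightarrow> real ^ ('n2 + 'j) \<Rightarrow> real ^ ('n2 + 'j)
     \<Rightarrow> real ^ ('k + ('m + 'j) + 1) ^ ('k + ('m + 'j) + 1)" where
  "cp_matrix D \<delta> i x lam s \<psi> \<phi> =
    (let Q = extQ D; W = extW D; T = extT D x; h = exth D x; F = diag \<phi>;
         u = - lam *\<^sub>R sample D i - (1/2) *\<^sub>R (transpose Q *v \<psi>);
         v = (1/2) *\<^sub>R (W *v \<psi> - h)
     in
      stack
        (beside (mat lam + transpose Q ** F ** Q)
          (beside (- (1/2) *\<^sub>R transpose T - transpose Q ** F ** transpose W)
                  (columnvector u)))
     (stack
        (beside (- (1/2) *\<^sub>R T - W ** F ** Q)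
          (beside (W ** F ** transpose W + mat \<delta>)
                  (columnvector v)))
        (beside (rowvector u)
          (beside (rowvector v)
                  (mat s)))))"

definition cp_feasible ::
  "('n1::finite, 'n2::finite, 'm::finite, 'k::finite, 'j::finite) dro_data
     \<Rightarrow> real \<Rightarrow> real ^ 'n1 \<Rightarrow> real \<Rightarrow> (nat \<Rightarrow> real)
     \<Rightarrow> (nat \<Rightarrow> real ^ ('n2 + 'j)) \<Rightarrow> (nat \<Rightarrow> real ^ ('n2 + 'j)) \<Rightarrow> bool" where
  "cp_feasible D \<delta> x lam s \<psi> \<phi> \<longleftrightarrow> x \<in> decisions D \<and> 0 \<le> lam \<and>
     (\<forall>i\<in>{1..nsamples D}. copositive (cp_matrix D \<delta> i x lam (s i) (\<psi> i) (\<phi> i)))"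

definition cp_cost ::
  "('n1::finite, 'n2::finite, 'm::finite, 'k::finite, 'j::finite) dro_data
     \<Rightarrow> real ^ 'n1 \<Rightarrow> real \<Rightarrow> (nat \<Rightarrow> real)
     \<Rightarrow> (nat \<Rightarrow> real ^ ('n2 + 'j)) \<Rightarrow> (nat \<Rightarrow> real ^ ('n2 + 'j)) \<Rightarrow> real" where
  "cp_cost D x lam s \<psi> \<phi> = cost D \<bullet> x + (radius D)\<^sup>2 * lam + (1 / real (nsamples D)) *
     (\<Sum>i\<in>{1..nsamples D}. s i + extq D \<bullet> \<psi> i - lam * (norm (sample D i))\<^sup>2
        + (\<Sum>j\<in>UNIV. \<phi> i $ j * (extq D $ j)\<^sup>2))"

definition cp_objective ::
  "('n1::finite, 'n2::finite, 'm::finite, 'k::finite, 'j::finite) dro_data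
     \<Rightarrow> real \<Rightarrow> real ^ 'n1 \<Rightarrow> ereal" where
  "cp_objective D \<delta> x = Inf {ereal (cp_cost D x lam s \<psi> \<phi>) | lam s \<psi> \<phi>.
     cp_feasible D \<delta> x lam s \<psi> \<phi>}"

definition cp_value ::
  "('n1::finite, 'n2::finite, 'm::finite, 'k::finite, 'j::finite) dro_data
     \<Rightarrow> real \<Rightarrow> ereal" where
  "cp_value D \<delta> = Inf {ereal (cp_cost D x lam s \<psi> \<phi>) | x lam s \<psi> \<phi>.
     cp_feasible D \<delta> x lam s \<psi> \<phi>}"


section \<open>Equivalence, minimizers and cluster points\<close>

definition cp_equivalent_dro ::
  "('n1::finite, 'n2::finite, 'm::finite, 'k::finite, 'j::finite) dro_data
     \<Rightarrow> real \<Rightarrow> bool" where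
  "cp_equivalent_dro D \<delta> \<longleftrightarrow> (\<forall>x\<in>decisions D. cp_objective D \<delta> x = dro_objective D x)"

definition cp_minimizer ::
  "('n1::finite, 'n2::finite, 'm::finite, 'k::finite, 'j::finite) dro_data
     \<Rightarrow> real \<Rightarrow> real ^ 'n1 \<Rightarrow> bool" where
  "cp_minimizer D \<delta> = is_arg_min (cp_objective D \<delta>) (\<lambda>x. x \<in> decisions D)"

definition dro_minimizer ::
  "('n1::finite, 'n2::finite, 'm::finite, 'k::finite, 'j::finite) dro_data
     \<Rightarrow> real ^ 'n1 \<Rightarrow> bool" where
  "dro_minimizer D = is_arg_min (dro_objective D) (\<lambda>x. x \<in> decisions D)"

definition cluster_point ::
  "(nat \<Rightarrow> 'a::metric_space) \<Rightarrow> 'a \<Rightarrow> bool" where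
  "cluster_point X l \<longleftrightarrow> (\<exists>r. strict_mono r \<and> (X \<circ> r) \<longlonglongrightarrow> l)"

end

theory Submission
  imports Defs
begin

text \<open>
  Write \<open>z = (\<xi>, p, \<tau>) \<ge> 0\<close> and let \<open>r\<close> be the residual of the homogenized constraint
  \<open>Q \<xi> + \<tau> q = W\<^sup>T p\<close>. With \<open>\<theta>\<close> the contribution of sample \<open>i\<close> to the
  objective of the copositive program, the quadratic form of its matrix at \<open>z\<close> is
  \<open>\<lambda> |\<xi> - \<tau> \<xi>\<^sub>i|\<^sup>2 - (T \<xi> + \<tau> h) \<bullet> p + \<delta> |p|\<^sup>2 + \<theta> \<tau>\<^sup>2\<close> plus terms that vanish when \<open>r = 0\<close>.
  Evaluating it at \<open>\<tau> = 1\<close>, \<open>r = 0\<close> shows that \<open>\<theta>\<close> bounds the regularized dual recourse value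
  minus the transport penalty. Conversely, the choice \<open>\<phi> = \<rho> 1\<close>, \<open>\<psi> = - 2 \<rho> q\<close> turns the
  vanishing terms into \<open>\<rho> |r|\<^sup>2\<close>, and by compactness of the unit sphere strict positivity on
  \<open>r = 0\<close> makes the form nonnegative for large \<open>\<rho>\<close>; no conic duality theory is needed.
  Positivity at \<open>\<tau> = 0\<close> is what requires complete recourse or \<open>\<delta> > 0\<close>.

  The program is thereby the Lagrangian dual of the worst case expectation. Weak duality follows by
  integrating against nearly optimal couplings, strong duality from separating the attainable pairs
  of transport cost and value in the plane (for radius zero, from the same compactness argument with
  \<open>\<lambda> = \<rho>\<close>). For the limit \<open>\<delta> \<rightarrow> 0\<close> the dual certificates stay bounded, so a subsequence
  converges to a certificate for \<open>\<delta> = 0\<close>.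
\<close>

section \<open>The quadratic form of the block matrix\<close>

lemma inner_stack [simp]: "stack a b \<bullet> stack c d = a \<bullet> c + b \<bullet> (d :: real ^ _)"
  by (simp add: inner_vec_def stack_def UNIV_Plus_UNIV[symmetric] sum.Plus del: UNIV_Plus_UNIV)

lemma stack_mult_vec [simp]: "stack A B *v x = stack (A *v x) (B *v x)"
  by (simp add: vec_eq_iff stack_def matrix_vector_mult_def split: sum.split)

lemma beside_mult_stack [simp]: "beside A B *v stack x y = A *v x + B *v (y :: real ^ _)"
  by (simp add: vec_eq_iff stack_def beside_def matrix_vector_mult_def UNIV_Plus_UNIV[symmetric]
      sum.Plus del: UNIV_Plus_UNIV)

lemma stack_cases:
  fixes z :: "'c ^ ('a::finite + 'b::finite)"
  obtains u v where "z = stack u v"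
proof
  show "z = stack (\<chi> i. z $ Inl i) (\<chi> i. z $ Inr i)"
    by (simp add: vec_eq_iff stack_def split: sum.split)
qed

lemma all_sum: "(\<forall>i::'a + 'b. P i) \<longleftrightarrow> (\<forall>a. P (Inl a)) \<and> (\<forall>b. P (Inr b))"
  by (metis sum.exhaust)

lemma stack_nonneg [simp]: "0 \<le> stack u v \<longleftrightarrow> 0 \<le> u \<and> 0 \<le> (v :: real ^ _)"
  by (auto simp: less_eq_vec_def stack_def all_sum)

lemma stack_eq_iff [simp]: "stack a b = stack c d \<longleftrightarrow> a = c \<and> b = d"
  by (auto simp: vec_eq_iff stack_def all_sum)

lemma stack_add: "stack a b + stack c d = stack (a + c) (b + (d :: real ^ _))"
  by (simp add: vec_eq_iff stack_def all_sum)

lemma transpose_stack_beside: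
  "transpose (stack (beside A B) (beside C D)) =
    stack (beside (transpose A) (transpose C)) (beside (transpose B) (transpose D))"
  by (simp add: vec_eq_iff stack_def beside_def transpose_def all_sum)

lemma beside_stack: "beside (stack A B) (stack C D) = stack (beside A C) (beside B D)"
  by (simp add: vec_eq_iff stack_def beside_def all_sum)

lemma transpose_beside: "transpose (beside A B) = stack (transpose A) (transpose B)"
  by (simp add: vec_eq_iff stack_def beside_def transpose_def all_sum)

lemma transpose_stack: "transpose (stack A B) = beside (transpose A) (transpose B)"
  by (simp add: vec_eq_iff stack_def beside_def transpose_def all_sum)

lemma columnvector_mult: "columnvector u *v v = v $ 1 *\<^sub>R (u :: real ^ _)"
  for v :: "real ^ 1"
  by (simp add: vec_eq_iff columnvector_def matrix_vector_mult_def UNIV_1)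

lemma rowvector_mult: "rowvector u *v v = vec (u \<bullet> v)"
  by (simp add: vec_eq_iff rowvector_def matrix_vector_mult_def inner_vec_def)

lemma mat_mult: "mat c *v v = c *\<^sub>R (v :: real ^ _)"
  by (simp add: vec_eq_iff mat_def matrix_vector_mult_def if_distrib if_distribR cong: if_cong)

lemma uminus_mult_vec: "(- A) *v v = - (A *v (v :: real ^ _))"
  by (simp add: vec_eq_iff matrix_vector_mult_def sum_negf)

lemma inner_vec_1: "(vec a :: real ^ 1) \<bullet> vec b = a * b"
  by (simp add: inner_vec_def UNIV_1)

lemma diag_mult: "(diag d *v v) $ i = d $ i * v $ i"
  by (simp add: diag_def matrix_vector_mult_def if_distrib if_distribR cong: if_cong)

lemma transpose_diag [simp]: "transpose (diag d) = diag d"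
  by (simp add: vec_eq_iff diag_def transpose_def)

section \<open>Dual recourse pairs and their homogenization\<close>

text \<open>The objective of the linear programming dual of the recourse problem, lowered by a
  quadratic regularization. The regularization is what the block \<open>\<delta> I\<close> of the
  matrix contributes.\<close>

definition payoff ::
  "('n1::finite, 'n2::finite, 'm::finite, 'k::finite, 'j::finite) dro_data
     \<Rightarrow> real \<Rightarrow> real ^ 'n1 \<Rightarrow> (real ^ 'k) \<times> (real ^ ('m + 'j)) \<Rightarrow> real" where
  "payoff D \<delta> x = (\<lambda>(\<xi>, p). (extT D x *v \<xi> + exth D x) \<bullet> p - \<delta> * (p \<bullet> p))"

text \<open>The feasible points of the dual recourse problem, with the scenario as a further
  variable. The lower block of the equation makes the lower block of \<open>p\<close> the slack of
  the constraints \<open>S \<xi> \<le> t\<close>, so \<open>0 \<le> p\<close> also encodes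
  membership in the support.\<close>

definition dual_pairs ::
  "('n1::finite, 'n2::finite, 'm::finite, 'k::finite, 'j::finite) dro_data
     \<Rightarrow> ((real ^ 'k) \<times> (real ^ ('m + 'j))) set" where
  "dual_pairs D = {(\<xi>, p). 0 \<le> \<xi> \<and> 0 \<le> p \<and> extQ D *v \<xi> + extq D = transpose (extW D) *v p}"

text \<open>The homogenized defect of the equation in \<open>dual_pairs\<close>; the equation itself
  is the case \<open>\<tau> = 1\<close>.\<close>

definition resid ::
  "('n1::finite, 'n2::finite, 'm::finite, 'k::finite, 'j::finite) dro_data
     \<Rightarrow> (real ^ 'k) \<times> (real ^ ('m + 'j)) \<times> real \<Rightarrow> real ^ ('n2 + 'j)" where
  "resid D = (\<lambda>(\<xi>, p, \<tau>). extQ D *v \<xi> + \<tau> *\<^sub>R extq D - transpose (extW D) *v p)"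

text \<open>The degree-two homogenization of
  \<open>\<theta> + lam |\<xi> - a|\<^sup>2 - payoff\<close>, the slack in the Lagrangian dual
  constraint of a sample located at \<open>a\<close>.\<close>

definition hom_gap ::
  "('n1::finite, 'n2::finite, 'm::finite, 'k::finite, 'j::finite) dro_data
     \<Rightarrow> real \<Rightarrow> real ^ 'n1 \<Rightarrow> real \<Rightarrow> real ^ 'k \<Rightarrow> real \<Rightarrow> (real ^ 'k) \<times> (real ^ ('m + 'j)) \<times> real \<Rightarrow> real" where
  "hom_gap D \<delta> x lam a \<theta> = (\<lambda>(\<xi>, p, \<tau>). lam * (norm (\<xi> - \<tau> *\<^sub>R a))\<^sup>2
     - (extT D x *v \<xi> + \<tau> *\<^sub>R exth D x) \<bullet> p + \<delta> * (p \<bullet> p) + \<theta> * \<tau>\<^sup>2)"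

definition cp_term ::
  "('n1::finite, 'n2::finite, 'm::finite, 'k::finite, 'j::finite) dro_data
     \<Rightarrow> nat \<Rightarrow> real \<Rightarrow> real \<Rightarrow> real ^ ('n2 + 'j) \<Rightarrow> real ^ ('n2 + 'j) \<Rightarrow> real" where
  "cp_term D i lam s \<psi> \<phi> = s + extq D \<bullet> \<psi> - lam * (norm (sample D i))\<^sup>2
     + (\<Sum>j\<in>UNIV. \<phi> $ j * (extq D $ j)\<^sup>2)"

lemma transpose_add: "transpose (A + B) = transpose A + transpose (B :: real ^ _ ^ _)"
  and transpose_diff: "transpose (A - B) = transpose A - transpose (B :: real ^ _ ^ _)"
  and transpose_uminus: "transpose (- A) = - transpose (A :: real ^ _ ^ _)"
  and transpose_scaleR: "transpose (r *\<^sub>R A) = r *\<^sub>R transpose A"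
  by (simp_all add: vec_eq_iff transpose_def)

lemma transpose_rowvector: "transpose (rowvector u) = columnvector u"
  and transpose_columnvector: "transpose (columnvector u) = rowvector u"
  by (simp_all add: vec_eq_iff transpose_def rowvector_def columnvector_def)

lemma cp_matrix_symmetric: "transpose (cp_matrix D \<delta> i x lam s \<psi> \<phi>) = cp_matrix D \<delta> i x lam s \<psi> \<phi>"
  unfolding cp_matrix_def Let_def
  by (simp add: transpose_stack_beside transpose_stack transpose_beside beside_stack transpose_add
      transpose_diff transpose_uminus transpose_scaleR transpose_rowvector transpose_columnvector
      matrix_transpose_mul matrix_mul_assoc)

text \<open>The entries of \<open>\<psi>\<close> and \<open>\<phi>\<close> enter only through
  \<open>Q \<xi> - W\<^sup>T p\<close>, which equals \<open>r - \<tau> q\<close>. Substituting this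
  collects all products free of \<open>r\<close> in the coefficient of
  \<open>\<tau>\<^sup>2\<close>, and completing the square in \<open>\<xi>\<close> adds
  \<open>- lam |\<xi>\<^sub>i|\<^sup>2\<close> to it. That coefficient is exactly the contribution
  of the sample to the objective.\<close>

lemma cp_form:
  fixes \<psi> \<phi> :: "real ^ ('n2::finite + 'j::finite)"
  assumes r: "r = resid D (\<xi>, p, \<tau>)"
  shows "stack \<xi> (stack p (vec \<tau>)) \<bullet> (cp_matrix D \<delta> i x lam s \<psi> \<phi> *v stack \<xi> (stack p (vec \<tau>))) =
    hom_gap D \<delta> x lam (sample D i) (cp_term D i lam s \<psi> \<phi>) (\<xi>, p, \<tau>)
     + (\<Sum>j\<in>UNIV. \<phi> $ j * (r $ j)\<^sup>2) - \<tau> * (\<Sum>j\<in>UNIV. (\<psi> $ j + 2 * \<phi> $ j * extq D $ j) * r $ j)"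
proof -
  define a where "a = extQ D *v \<xi>"
  define b where "b = p v* extW D"
  have F: "(diag \<phi> *v u) \<bullet> v = (\<Sum>j\<in>UNIV. \<phi> $ j * (u $ j * v $ j))" for u v
    by (simp add: inner_vec_def diag_mult mult_ac)
  have Q: "\<xi> \<bullet> (v v* extQ D) = a \<bullet> v" for v
    by (metis a_def dot_lmul_matrix inner_commute)
  have W: "p \<bullet> (extW D *v v) = b \<bullet> v" for v
    by (simp add: b_def dot_lmul_matrix)
  have T: "\<xi> \<bullet> (p v* extT D x) = (extT D x *v \<xi>) \<bullet> p"
    by (metis dot_lmul_matrix inner_commute)
  have diag_swap: "v \<bullet> (diag \<phi> *v u) = (diag \<phi> *v u) \<bullet> v" for u v
    by (rule inner_commute)
  \<comment> \<open>These equations orient every inner product the same way, so that the upper and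
    the lower off-diagonal blocks produce identical terms.\<close>
  have C: "(v v* extQ D) \<bullet> \<xi> = a \<bullet> v" "(extW D *v w) \<bullet> p = b \<bullet> w"
    "(diag \<phi> *v b) \<bullet> a = (diag \<phi> *v a) \<bullet> b" "exth D x \<bullet> p = p \<bullet> exth D x"
    "sample D i \<bullet> \<xi> = \<xi> \<bullet> sample D i" "p \<bullet> (extT D x *v \<xi>) = (extT D x *v \<xi>) \<bullet> p" for v w
    using Q W by (auto simp: inner_commute inner_vec_def diag_mult mult_ac)
  have "stack \<xi> (stack p (vec \<tau>)) \<bullet> (cp_matrix D \<delta> i x lam s \<psi> \<phi> *v stack \<xi> (stack p (vec \<tau>))) =
     lam * (\<xi> \<bullet> \<xi>) - (extT D x *v \<xi>) \<bullet> p + \<delta> * (p \<bullet> p) + (diag \<phi> *v a) \<bullet> a - 2 * ((diag \<phi> *v a) \<bullet> b)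
     + (diag \<phi> *v b) \<bullet> b + 2 * \<tau> * (- lam * (\<xi> \<bullet> sample D i) - (1/2) * (a \<bullet> \<psi>))
     + \<tau> * (b \<bullet> \<psi> - p \<bullet> exth D x) + s * \<tau>\<^sup>2"
    unfolding cp_matrix_def Let_def
    by (simp add: beside_stack matrix_vector_mult_add_rdistrib matrix_vector_mult_diff_rdistrib
      scaleR_matrix_vector_assoc[symmetric] matrix_vector_mul_assoc[symmetric] mat_mult columnvector_mult
      rowvector_mult uminus_mult_vec inner_vec_1 inner_add_right inner_diff_left inner_add_left inner_diff_right Q W T
      a_def[symmetric] b_def[symmetric] diag_swap C)
      (simp add: field_simps power2_eq_square)
  also have "\<dots> = hom_gap D \<delta> x lam (sample D i) (cp_term D i lam s \<psi> \<phi>) (\<xi>, p, \<tau>)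
     + (\<Sum>j\<in>UNIV. \<phi> $ j * (r $ j)\<^sup>2) - \<tau> * (\<Sum>j\<in>UNIV. (\<psi> $ j + 2 * \<phi> $ j * extq D $ j) * r $ j)"
  proof -
    have n: "(norm (\<xi> - \<tau> *\<^sub>R sample D i))\<^sup>2
        = \<xi> \<bullet> \<xi> - 2 * \<tau> * (\<xi> \<bullet> sample D i) + \<tau>\<^sup>2 * (norm (sample D i))\<^sup>2"
      unfolding power2_norm_eq_inner
      by (simp add: inner_diff_left inner_diff_right inner_commute
          power2_eq_square algebra_simps)
    \<comment> \<open>Per coordinate this is the expansion of
      \<open>\<phi> (r - \<tau> q)\<^sup>2 - \<tau> \<psi> (r - \<tau> q)\<close> with
      \<open>r - \<tau> q = a - b\<close>.\<close>
    have "(\<Sum>j\<in>UNIV. \<phi> $ j * (r $ j)\<^sup>2) - \<tau> * (\<Sum>j\<in>UNIV. (\<psi> $ j + 2 * \<phi> $ j * extq D $ j) * r $ j)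
        + \<tau>\<^sup>2 * (extq D \<bullet> \<psi> + (\<Sum>j\<in>UNIV. \<phi> $ j * (extq D $ j)\<^sup>2))
      = (\<Sum>j\<in>UNIV. \<phi> $ j * (r $ j)\<^sup>2 - \<tau> * ((\<psi> $ j + 2 * \<phi> $ j * extq D $ j) * r $ j)
          + \<tau>\<^sup>2 * (extq D $ j * \<psi> $ j + \<phi> $ j * (extq D $ j)\<^sup>2))"
      by (simp add: inner_vec_def sum.distrib sum_subtractf sum_distrib_left distrib_left)
    also have "\<dots> = (\<Sum>j\<in>UNIV. \<phi> $ j * (a $ j * a $ j) - 2 * (\<phi> $ j * (a $ j * b $ j))
        + \<phi> $ j * (b $ j * b $ j) - \<tau> * (a $ j * \<psi> $ j) + \<tau> * (b $ j * \<psi> $ j))"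
      by (rule sum.cong) (auto simp: r resid_def a_def b_def power2_eq_square algebra_simps)
    also have "\<dots> = (diag \<phi> *v a) \<bullet> a - 2 * ((diag \<phi> *v a) \<bullet> b) + (diag \<phi> *v b) \<bullet> b
        - \<tau> * (a \<bullet> \<psi>) + \<tau> * (b \<bullet> \<psi>)"
      unfolding F by (simp add: inner_vec_def sum.distrib sum_subtractf sum_distrib_left)
    finally show ?thesis
      unfolding hom_gap_def cp_term_def prod.case n inner_add_left inner_scaleR_left C
      by (simp add: power2_eq_square algebra_simps)
  qed
  finally show ?thesis .
qed

definition conic_cone :: "((real ^ 'k) \<times> (real ^ 'm) \<times> real) set" where
  "conic_cone = {(\<xi>, p, \<tau>). 0 \<le> \<xi> \<and> 0 \<le> p \<and> 0 \<le> \<tau>}"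

lemma vec_nonneg [simp]: "0 \<le> (vec c :: real ^ 'n) \<longleftrightarrow> 0 \<le> c"
  by (simp add: less_eq_vec_def)

text \<open>Symmetry is automatic, and each nonnegative vector of the block dimension is a triple
  from \<open>conic_cone\<close>, so copositivity amounts to nonnegativity of the expression from
  \<open>cp_form\<close>.\<close>

lemma copositive_cp_matrix_iff:
  fixes D :: "('n1::finite, 'n2::finite, 'm::finite, 'k::finite, 'j::finite) dro_data"
  shows
  "copositive (cp_matrix D \<delta> i x lam s \<psi> \<phi>) \<longleftrightarrow>
    (\<forall>z\<in>conic_cone. 0 \<le> hom_gap D \<delta> x lam (sample D i) (cp_term D i lam s \<psi> \<phi>) z
     + (\<Sum>j\<in>UNIV. \<phi> $ j * (resid D z $ j)\<^sup>2)
     - snd (snd z) * (\<Sum>j\<in>UNIV. (\<psi> $ j + 2 * \<phi> $ j * extq D $ j) * resid D z $ j))"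
  (is "?L \<longleftrightarrow> (\<forall>z\<in>_. 0 \<le> ?f z)")
proof -
  let ?M = "cp_matrix D \<delta> i x lam s \<psi> \<phi>"
  have *: "stack \<xi> (stack p (vec \<tau>)) \<bullet> (?M *v stack \<xi> (stack p (vec \<tau>))) = ?f (\<xi>, p, \<tau>)"
    for \<xi> :: "real ^ 'k" and p :: "real ^ ('m + 'j)" and \<tau>
    by (simp add: cp_form[OF refl])
  have "?L \<longleftrightarrow> (\<forall>z. 0 \<le> z \<longrightarrow> 0 \<le> z \<bullet> (?M *v z))"
    by (simp add: copositive_def cp_matrix_symmetric)
  also have "\<dots> \<longleftrightarrow> (\<forall>(\<xi> :: real ^ 'k) (p :: real ^ ('m + 'j)) \<tau>. 0 \<le> \<xi> \<and> 0 \<le> p \<and> 0 \<le> \<tau> \<longrightarrow> 0 \<le> ?f (\<xi>, p, \<tau>))"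
  proof safe
    fix \<xi> :: "real ^ 'k" and p :: "real ^ ('m + 'j)" and \<tau>
    assume "\<forall>z. 0 \<le> z \<longrightarrow> 0 \<le> z \<bullet> (?M *v z)" "0 \<le> \<xi>" "0 \<le> p" "0 \<le> (\<tau>::real)"
    then show "0 \<le> ?f (\<xi>, p, \<tau>)"
      unfolding *[symmetric] by simp
  next
    fix z :: "real ^ ('k + ('m + 'j) + 1)"
    assume f: "\<forall>\<xi> p \<tau>. 0 \<le> \<xi> \<and> 0 \<le> p \<and> 0 \<le> \<tau> \<longrightarrow> 0 \<le> ?f (\<xi>, p, \<tau>)" and "0 \<le> z"
    obtain \<xi> w where w: "z = stack \<xi> w" by (rule stack_cases)
    obtain p t where t: "w = stack p t" by (rule stack_cases)
    have "t = vec (t $ 1)" by (simp add: vec_eq_iff forall_1)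
    then obtain \<tau> where z: "z = stack \<xi> (stack p (vec \<tau>))"
      using w t by metis
    with \<open>0 \<le> z\<close> have "0 \<le> \<xi>" "0 \<le> p" "0 \<le> \<tau>"
      by auto
    with f show "0 \<le> z \<bullet> (?M *v z)"
      unfolding z * by blast
  qed
  also have "\<dots> \<longleftrightarrow> (\<forall>z\<in>conic_cone. 0 \<le> ?f z)"
    by (auto simp: conic_cone_def)
  finally show ?thesis .
qed

text \<open>Weak duality for one sample: at \<open>\<tau> = 1\<close> a dual pair has residual zero,
  and all terms with \<open>\<psi>\<close> and \<open>\<phi>\<close> disappear from the quadratic
  form.\<close>

lemma payoff_le_cp_term:
  assumes "copositive (cp_matrix D \<delta> i x lam s \<psi> \<phi>)" and "(\<xi>, p) \<in> dual_pairs D"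
  shows "payoff D \<delta> x (\<xi>, p) - lam * (norm (\<xi> - sample D i))\<^sup>2 \<le> cp_term D i lam s \<psi> \<phi>"
proof -
  have "(\<xi>, p, 1) \<in> conic_cone" "resid D (\<xi>, p, 1) = 0"
    using assms(2) by (auto simp: conic_cone_def dual_pairs_def resid_def)
  with assms(1) show ?thesis
    unfolding copositive_cp_matrix_iff by (force simp: hom_gap_def payoff_def)
qed

text \<open>A constant \<open>\<phi>\<close> turns the quadratic residual term into the penalty
  \<open>\<rho> |r|\<^sup>2\<close>, and \<open>\<psi>\<close> is chosen to cancel the term that is
  linear in the residual.\<close>

lemma copositive_of_hom_gap:
  fixes D :: "('n1::finite, 'n2::finite, 'm::finite, 'k::finite, 'j::finite) dro_data"
  assumes "\<forall>z\<in>conic_cone. 0 \<le> hom_gap D \<delta> x lam (sample D i) \<theta> z + \<rho> * (norm (resid D z))\<^sup>2"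
  shows "\<exists>s \<psi> \<phi>. copositive (cp_matrix D \<delta> i x lam s \<psi> \<phi>) \<and> cp_term D i lam s \<psi> \<phi> = \<theta>"
proof -
  define \<phi> where "\<phi> = (vec \<rho> :: real ^ ('n2 + 'j))"
  define \<psi> where "\<psi> = - (2 * \<rho>) *\<^sub>R extq D"
  \<comment> \<open>\<open>cp_term\<close> depends on \<open>s\<close> only as an additive constant,
    so this choice gives it the value \<open>\<theta>\<close>.\<close>
  define s where "s = \<theta> - cp_term D i lam 0 \<psi> \<phi>"
  have t: "cp_term D i lam s \<psi> \<phi> = \<theta>"
    by (simp add: s_def cp_term_def)
  have "(\<Sum>j\<in>UNIV. \<phi> $ j * (v $ j)\<^sup>2) = \<rho> * (norm v)\<^sup>2" for v
    unfolding power2_norm_eq_inner by (simp add: \<phi>_def inner_vec_def power2_eq_square sum_distrib_left)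
  moreover have "\<psi> $ j + 2 * \<phi> $ j * extq D $ j = 0" for j
    by (simp add: \<phi>_def \<psi>_def)
  ultimately have "copositive (cp_matrix D \<delta> i x lam s \<psi> \<phi>)"
    using assms by (simp add: copositive_cp_matrix_iff t)
  with t show ?thesis by blast
qed

section \<open>Exact penalties on compact sets and on the cone\<close>

text \<open>Only the compact set where \<open>G \<le> 0\<close> needs a penalty, and there
  \<open>H\<close> is positive, hence bounded below by a positive minimum.\<close>

lemma penalty_compact:
  fixes G H :: "'a::t2_space \<Rightarrow> real"
  assumes "compact C" "continuous_on C G" "continuous_on C H"
    and "\<forall>z\<in>C. 0 \<le> H z" "\<forall>z\<in>C. H z = 0 \<longrightarrow> 0 < G z"
  shows "\<exists>\<rho>0\<ge>0. \<forall>\<rho>\<ge>\<rho>0. \<forall>z\<in>C. 0 \<le> G z + \<rho> * H z"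
proof -
  define C' where "C' = C \<inter> G -` {..0}"
  have "closed C'"
    unfolding C'_def by (intro continuous_closed_preimage assms(2) compact_imp_closed[OF assms(1)]) auto
  then have "compact C'"
    using compact_Int_closed[OF assms(1), of C'] by (simp add: C'_def)
  show ?thesis
  proof (cases "C' = {}")
    case True
    then have "0 < G z" if "z \<in> C" for z
      using that by (force simp: C'_def)
    then show ?thesis
      using assms(4) by (intro exI[of _ 0]) (simp add: add_nonneg_nonneg less_imp_le)
  next
    case False
    have "C' \<subseteq> C" by (auto simp: C'_def)
    obtain a where a: "a \<in> C'" "\<forall>z\<in>C'. G a \<le> G z"
      using continuous_attains_inf[OF \<open>compact C'\<close> False] assms(2) \<open>C' \<subseteq> C\<close> continuous_on_subset by metis
    obtain b where b: "b \<in> C'" "\<forall>z\<in>C'. H b \<le> H z"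
      using continuous_attains_inf[OF \<open>compact C'\<close> False] assms(3) \<open>C' \<subseteq> C\<close> continuous_on_subset by metis
    have "0 < H b" "G a \<le> 0"
      using a b assms(4,5) by (force simp: C'_def)+
    show ?thesis
    \<comment> \<open>The minimum of \<open>G\<close> over \<open>C'\<close> is \<open>G a\<close>
      and that of \<open>H\<close> is \<open>H b\<close>, so from this weight on the penalty
      outweighs the worst deficit.\<close>
    proof (intro exI[of _ "- G a / H b"] conjI allI impI ballI)
      show "0 \<le> - G a / H b" using \<open>0 < H b\<close> \<open>G a \<le> 0\<close> by (simp add: divide_nonpos_pos)
      fix \<rho> z assume \<rho>: "- G a / H b \<le> \<rho>" and z: "z \<in> C"
      have "0 \<le> \<rho>" using \<rho> \<open>0 \<le> - G a / H b\<close> by linarith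
      show "0 \<le> G z + \<rho> * H z"
      proof (cases "z \<in> C'")
        case True
        have "- G a \<le> \<rho> * H b" using \<rho> \<open>0 < H b\<close> by (simp add: field_simps)
        also have "\<dots> \<le> \<rho> * H z" using \<open>0 \<le> \<rho>\<close> b True by (simp add: mult_left_mono)
        finally show ?thesis using a True by force
      next
        case False
        then show ?thesis using z \<open>0 \<le> \<rho>\<close> assms(4) by (auto simp: C'_def)
      qed
    qed
  qed
qed

text \<open>Both functions are homogeneous of degree two, so it suffices to work on the intersection
  of the closed cone with the unit sphere, which is compact.\<close>

lemma penalty_cone:
  fixes G H :: "(real ^ 'k) \<times> (real ^ 'm) \<times> real \<Rightarrow> real"
  assumes "continuous_on UNIV G" "continuous_on UNIV H"
    and "\<And>c z. G (c *\<^sub>R z) = c\<^sup>2 * G z" "\<And>c z. H (c *\<^sub>R z) = c\<^sup>2 * H z" "\<And>z. 0 \<le> H z"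
    and pos: "\<And>z. z \<in> conic_cone \<Longrightarrow> z \<noteq> 0 \<Longrightarrow> H z = 0 \<Longrightarrow> 0 < G z"
  shows "\<exists>\<rho>0\<ge>0. \<forall>\<rho>\<ge>\<rho>0. \<forall>z\<in>conic_cone. 0 \<le> G z + \<rho> * H z"
proof -
  have "closed (conic_cone :: ((real ^ 'k) \<times> (real ^ 'm) \<times> real) set)"
  proof -
    have eq: "conic_cone = {z :: (real ^ 'k) \<times> (real ^ 'm) \<times> real. (\<forall>i. 0 \<le> fst z $ i) \<and>
        (\<forall>i. 0 \<le> fst (snd z) $ i) \<and> 0 \<le> snd (snd z)}"
      by (auto simp: conic_cone_def less_eq_vec_def)
    show ?thesis
      unfolding eq
      by (intro closed_Collect_conj closed_Collect_all closed_Collect_le continuous_intros continuous_on_component)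
  qed
  then have "compact (sphere 0 1 \<inter> conic_cone :: ((real ^ 'k) \<times> (real ^ 'm) \<times> real) set)"
    by (intro compact_Int_closed) auto
  then obtain \<rho>0 where \<rho>0: "0 \<le> \<rho>0"
      "\<And>\<rho> z. \<rho> \<ge> \<rho>0 \<Longrightarrow> z \<in> sphere 0 1 \<inter> conic_cone \<Longrightarrow> 0 \<le> G z + \<rho> * H z"
    using penalty_compact[of "sphere 0 1 \<inter> conic_cone" G H] assms
    by (metis (no_types, lifting) IntD1 IntD2 continuous_on_subset mem_sphere_0 norm_zero subset_UNIV zero_neq_one)
  have "0 \<le> G z + \<rho> * H z" if "\<rho> \<ge> \<rho>0" "z \<in> conic_cone" for \<rho> z
  proof (cases "z = 0")
    case True
    \<comment> \<open>Homogeneity with factor zero makes both functions vanish at the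
      origin.\<close>
    then show ?thesis using assms(3,4)[of 0 0] by simp
  next
    case False
    define u where "u = (1 / norm z) *\<^sub>R z"
    have "u \<in> sphere 0 1 \<inter> conic_cone"
      using that(2) False by (auto simp: u_def conic_cone_def less_eq_vec_def)
    then have "0 \<le> (norm z)\<^sup>2 * (G u + \<rho> * H u)" using \<rho>0 that(1) by simp
    also have "\<dots> = G (norm z *\<^sub>R u) + \<rho> * H (norm z *\<^sub>R u)"
      unfolding assms(3,4) by (simp add: algebra_simps)
    also have "norm z *\<^sub>R u = z" using False by (simp add: u_def)
    finally show ?thesis .
  qed
  then show ?thesis using \<rho>0(1) by blast
qed

lemma resid_scaleR: "resid D (c *\<^sub>R z) = c *\<^sub>R resid D z"
  by (cases z) (simp add: resid_def matrix_vector_mult_scaleR scaleR_diff_right scaleR_add_right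
      del: transpose_matrix_vector)

lemma norm_scaleR_diff:
  fixes a \<xi> :: "'a::real_normed_vector"
  shows "(norm (c *\<^sub>R \<xi> - (c * \<tau>) *\<^sub>R a))\<^sup>2 = c\<^sup>2 * (norm (\<xi> - \<tau> *\<^sub>R a))\<^sup>2"
  by (metis norm_scaleR power_mult_distrib power2_abs scaleR_diff_right scaleR_scaleR)

lemma hom_gap_scaleR: "hom_gap D \<delta> x lam a \<theta> (c *\<^sub>R z) = c\<^sup>2 * hom_gap D \<delta> x lam a \<theta> z"
proof (cases z)
  case (fields \<xi> p \<tau>)
  have "(extT D x *v (c *\<^sub>R \<xi>) + (c * \<tau>) *\<^sub>R exth D x) \<bullet> (c *\<^sub>R p)
      = c\<^sup>2 * ((extT D x *v \<xi> + \<tau> *\<^sub>R exth D x) \<bullet> p)"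
    by (simp add: matrix_vector_mult_scaleR inner_add_left power2_eq_square algebra_simps)
  then show ?thesis
    using norm_scaleR_diff[of c \<xi> \<tau> a]
    by (simp add: fields hom_gap_def power_mult_distrib power2_eq_square[of c] algebra_simps)
qed

lemma continuous_matrix_vector_mult [continuous_intros]:
  fixes A :: "real ^ 'n ^ 'm"
  assumes "continuous_on S f"
  shows "continuous_on S (\<lambda>x. A *v f x)"
  using assms by (rule bounded_linear.continuous_on[OF matrix_vector_mul_bounded_linear])

lemma continuous_hom_gap: "continuous_on UNIV (hom_gap D \<delta> x lam a \<theta>)"
  unfolding hom_gap_def case_prod_unfold by (intro continuous_intros)

lemma continuous_resid: "continuous_on UNIV (resid D)"
  unfolding resid_def case_prod_unfold by (intro continuous_intros)

text \<open>Strong duality for one sample: strict positivity on the slice of zero residual survives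
  off the slice once the residual is penalized, so the value \<open>\<theta>\<close> is attained
  exactly by feasible matrix variables.\<close>

lemma copositive_attained:
  assumes "\<And>z. z \<in> conic_cone \<Longrightarrow> z \<noteq> 0 \<Longrightarrow> resid D z = 0 \<Longrightarrow> 0 < hom_gap D \<delta> x lam (sample D i) \<theta> z"
  shows "\<exists>s \<psi> \<phi>. copositive (cp_matrix D \<delta> i x lam s \<psi> \<phi>) \<and> cp_term D i lam s \<psi> \<phi> = \<theta>"
proof -
  have "\<exists>\<rho>0\<ge>0. \<forall>\<rho>\<ge>\<rho>0. \<forall>z\<in>conic_cone.
      0 \<le> hom_gap D \<delta> x lam (sample D i) \<theta> z + \<rho> * (norm (resid D z))\<^sup>2"
    by (rule penalty_cone) (auto simp: hom_gap_scaleR resid_scaleR power_mult_distrib assms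
        intro!: continuous_hom_gap continuous_resid continuous_intros)
  then show ?thesis
    using copositive_of_hom_gap by blast
qed

text \<open>The version for radius zero, where \<open>lam\<close> has no weight in the objective and
  may be large. The transport term then becomes a second penalty, and positivity is only required on
  the ray over the sample.\<close>

lemma copositive_attained_at_sample:
  assumes "\<And>z. z \<in> conic_cone \<Longrightarrow> z \<noteq> 0 \<Longrightarrow> resid D z = 0 \<Longrightarrow> fst z = snd (snd z) *\<^sub>R sample D i \<Longrightarrow>
      0 < hom_gap D \<delta> x 0 (sample D i) \<theta> z"
  shows "\<exists>lam0\<ge>0. \<forall>lam\<ge>lam0.
    \<exists>s \<psi> \<phi>. copositive (cp_matrix D \<delta> i x lam s \<psi> \<phi>) \<and> cp_term D i lam s \<psi> \<phi> = \<theta>"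
proof -
  define H where "H = (\<lambda>z. (norm (resid D z))\<^sup>2 + (norm (fst z - snd (snd z) *\<^sub>R sample D i))\<^sup>2)"
  have "\<exists>\<rho>0\<ge>0. \<forall>\<rho>\<ge>\<rho>0. \<forall>z\<in>conic_cone. 0 \<le> hom_gap D \<delta> x 0 (sample D i) \<theta> z + \<rho> * H z"
  proof (rule penalty_cone)
    fix z assume "z \<in> conic_cone" "z \<noteq> 0" "H z = 0"
    then show "0 < hom_gap D \<delta> x 0 (sample D i) \<theta> z"
      using assms[of z] by (simp add: H_def add_nonneg_eq_0_iff)
  qed (auto simp: hom_gap_scaleR resid_scaleR power_mult_distrib norm_scaleR_diff H_def algebra_simps
        intro!: continuous_hom_gap continuous_resid continuous_intros)
  \<comment> \<open>The gap is affine in \<open>lam\<close> with the squared distance as slope, so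
    one number \<open>\<rho>\<close> serves both as multiplier and as residual penalty.\<close>
  moreover have "hom_gap D \<delta> x 0 (sample D i) \<theta> z + \<rho> * H z
      = hom_gap D \<delta> x \<rho> (sample D i) \<theta> z + \<rho> * (norm (resid D z))\<^sup>2" for \<rho> z
    by (cases z) (simp add: hom_gap_def H_def algebra_simps)
  ultimately show ?thesis
    using copositive_of_hom_gap by metis
qed

section \<open>Linear programming duality for the recourse function\<close>

lemma transpose_mult_inner: "(transpose A *v p) \<bullet> y = (A *v y) \<bullet> (p :: real ^ _)"
  by (metis dot_lmul_matrix inner_commute transpose_matrix_vector)

lemma transpose_extW_mult: "transpose (extW D) *v stack p1 p2 = stack (transpose (Wmat D) *v p1) (- p2)"
  by (simp add: extW_def transpose_stack_beside uminus_mult_vec transpose_uminus transpose_mat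
      stack_add del: transpose_matrix_vector)
   (simp add: transpose_def zero_vec_def vec_eq_iff matrix_vector_mult_def stack_def all_sum)

text \<open>The lower block \<open>- I\<close> of the extended matrix forces \<open>p2\<close> to be
  the slack of the support constraints. This is how the extended parameters carry the polyhedron
  into the copositive program.\<close>

lemma dual_pairs_stack_iff:
  "(\<xi>, stack p1 p2) \<in> dual_pairs D \<longleftrightarrow>
    \<xi> \<in> support D \<and> 0 \<le> p1 \<and> Qmat D *v \<xi> + qvec D = transpose (Wmat D) *v p1 \<and> p2 = tvec D - Smat D *v \<xi>"
proof -
  have "(\<xi>, stack p1 p2) \<in> dual_pairs D \<longleftrightarrow> 0 \<le> \<xi> \<and> 0 \<le> p1 \<and> 0 \<le> p2 \<and>
      Qmat D *v \<xi> + qvec D = transpose (Wmat D) *v p1 \<and> Smat D *v \<xi> - tvec D = - p2"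
    by (auto simp add: dual_pairs_def transpose_extW_mult extQ_def extq_def stack_add
        simp del: transpose_matrix_vector)
  also have "\<dots> \<longleftrightarrow> \<xi> \<in> support D \<and> 0 \<le> p1 \<and> Qmat D *v \<xi> + qvec D = transpose (Wmat D) *v p1 \<and>
      p2 = tvec D - Smat D *v \<xi>"
    by (auto simp: support_def less_eq_vec_def vec_eq_iff algebra_simps)
      (metis add.commute le_add_same_cancel1 le_add_same_cancel2)+
  finally show ?thesis .
qed

lemma payoff_stack:
  "payoff D \<delta> x (\<xi>, stack p1 p2) =
    (Tmap D x *v \<xi> + hmap D x) \<bullet> p1 - \<delta> * (p1 \<bullet> p1 + p2 \<bullet> p2)"
  by (simp add: payoff_def extT_def exth_def stack_add)

lemma dual_pairs_support: "(\<xi>, p) \<in> dual_pairs D \<Longrightarrow> \<xi> \<in> support D"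
  by (metis dual_pairs_stack_iff stack_cases)

lemma dual_pairs_exists:
  assumes "sufficiently_expensive_recourse D" "\<xi> \<in> support D"
  shows "\<exists>p. (\<xi>, p) \<in> dual_pairs D"
  using assms by (metis dual_pairs_stack_iff sufficiently_expensive_recourse_def)

lemma inner_nonneg_mono:
  fixes u v p :: "real ^ 'a"
  assumes "0 \<le> p" "u \<le> v"
  shows "u \<bullet> p \<le> v \<bullet> p"
  using assms by (auto simp: inner_vec_def less_eq_vec_def intro!: sum_mono mult_right_mono)

text \<open>Weak linear programming duality; for \<open>0 \<le> \<delta>\<close> the regularization
  only lowers the dual value.\<close>

lemma payoff_le_recourse:
  assumes "(\<xi>, p) \<in> dual_pairs D" "0 \<le> \<delta>"
  shows "ereal (payoff D \<delta> x (\<xi>, p)) \<le> recourse D x \<xi>"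
  unfolding recourse_def
proof (rule Inf_greatest, clarsimp)
  fix y assume y: "Tmap D x *v \<xi> + hmap D x \<le> Wmat D *v y"
  obtain p1 p2 where p: "p = stack p1 p2" by (rule stack_cases)
  have d: "0 \<le> p1" "Qmat D *v \<xi> + qvec D = transpose (Wmat D) *v p1"
    using assms(1) unfolding p dual_pairs_stack_iff by auto
  have "payoff D \<delta> x (\<xi>, p) \<le> (Tmap D x *v \<xi> + hmap D x) \<bullet> p1"
    using assms(2) by (simp add: p payoff_stack)
  also have "\<dots> \<le> (Wmat D *v y) \<bullet> p1"
    by (rule inner_nonneg_mono) (use y d in auto)
  also have "\<dots> = (Qmat D *v \<xi> + qvec D) \<bullet> y"
    by (simp only: d(2) transpose_mult_inner)
  finally show "payoff D \<delta> x (\<xi>, p) \<le> (Qmat D *v \<xi> + qvec D) \<bullet> y" .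
qed

text \<open>A Farkas argument. The pairs of dual right-hand side and attainable value form a
  finitely generated cone, which is closed. As \<open>w\<close> exceeds every dual value for
  \<open>c\<close>, the point \<open>(c, w)\<close> is separated from the cone, and the separating
  functional rescales to a primal solution.\<close>

lemma linear_program_duality:
  fixes W :: "real ^ 'n ^ 'm" and b :: "real ^ 'm" and c :: "real ^ 'n"
  assumes p0: "0 \<le> p0" "c = transpose W *v p0"
    and ub: "\<And>p. 0 \<le> p \<Longrightarrow> c = transpose W *v p \<Longrightarrow> b \<bullet> p \<le> v" and "v < w"
  shows "\<exists>y. b \<le> W *v y \<and> c \<bullet> y < w"
proof -
  \<comment> \<open>One generator per dual variable; \<open>(0, - 1)\<close> allows the value to be
    lowered freely.\<close>
  define G where "G = insert (0, - 1 :: real) (range (\<lambda>i. (row i W, b $ i)))"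
  define C where "C = {(transpose W *v p, b \<bullet> p - r) | p r. 0 \<le> p \<and> 0 \<le> r}"
  have C: "convex_cone hull G \<subseteq> C"
  proof (rule hull_minimal)
    have "(0, - 1) \<in> C"
      unfolding C_def by (rule CollectI, intro exI[of _ 0] exI[of _ 1]) auto
    moreover have "(row i W, b $ i) \<in> C" for i
      unfolding C_def
      by (rule CollectI, intro exI[of _ "axis i 1"] exI[of _ 0])
        (auto simp: less_eq_vec_def axis_def vec_eq_iff row_def vector_matrix_mult_def inner_vec_def
          if_distrib if_distribR cong: if_cong)
    ultimately show "G \<subseteq> C" by (auto simp: G_def)
    show "convex_cone C"
      unfolding convex_cone_iff
    proof (intro conjI ballI allI impI)
      show "0 \<in> C"
        unfolding C_def by (rule CollectI, intro exI[of _ 0]) (auto simp: zero_prod_def)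
    next
      fix z z' assume "z \<in> C" "z' \<in> C"
      then obtain p r p' r' where "z = (transpose W *v p, b \<bullet> p - r)" "0 \<le> p" "0 \<le> r"
          "z' = (transpose W *v p', b \<bullet> p' - r')" "0 \<le> p'" "0 \<le> r'"
        unfolding C_def by blast
      then show "z + z' \<in> C"
        unfolding C_def
        by (intro CollectI exI[of _ "p + p'"] exI[of _ "r + r'"])
          (auto simp add: matrix_vector_right_distrib inner_add_right less_eq_vec_def
            simp del: transpose_matrix_vector)
    next
      fix z and k :: real assume "z \<in> C" "0 \<le> k"
      then obtain p r where "z = (transpose W *v p, b \<bullet> p - r)" "0 \<le> p" "0 \<le> r"
        unfolding C_def by blast
      with \<open>0 \<le> k\<close> show "k *\<^sub>R z \<in> C"
        unfolding C_def
        by (intro CollectI exI[of _ "k *\<^sub>R p"] exI[of _ "k * r"])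
          (auto simp add: matrix_vector_mult_scaleR less_eq_vec_def algebra_simps
            simp del: transpose_matrix_vector)
    qed
  qed
  have "(c, w) \<notin> convex_cone hull G"
  proof
    assume "(c, w) \<in> convex_cone hull G"
    then obtain p r where "c = transpose W *v p" "w = b \<bullet> p - r" "0 \<le> p" "0 \<le> r"
      using C unfolding C_def by auto
    with ub[of p] \<open>v < w\<close> show False by simp
  qed
  moreover have "closed (convex_cone hull G)"
    by (rule closed_convex_cone_hull) (simp add: G_def)
  ultimately obtain a k where a: "a \<bullet> (c, w) < k" "\<And>z. z \<in> convex_cone hull G \<Longrightarrow> k < a \<bullet> z"
    using separating_hyperplane_closed_point[OF convex_convex_cone_hull] by metis
  obtain y \<alpha> where y: "a = (y, \<alpha>)" by (cases a)
  have "k < 0" using a(2)[OF convex_cone_hull_contains_0] by simp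
  \<comment> \<open>If the functional were negative on a generator, the multiple of that generator
    by \<open>k / (a \<bullet> z)\<close> would lie in the cone and take the forbidden value
    \<open>k\<close>.\<close>
  have pos: "0 \<le> a \<bullet> z" if "z \<in> G" for z
  proof (rule ccontr)
    assume "\<not> 0 \<le> a \<bullet> z"
    then have "(k / (a \<bullet> z)) *\<^sub>R z \<in> convex_cone hull G"
      using that \<open>k < 0\<close> by (intro convex_cone_hull_mul hull_inc) (auto simp: divide_nonpos_nonpos)
    from a(2)[OF this] show False using \<open>\<not> 0 \<le> a \<bullet> z\<close> by simp
  qed
  define \<beta> where "\<beta> = - \<alpha>"
  have "0 \<le> \<beta>" using pos[of "(0, - 1)"] by (simp add: G_def y \<beta>_def)
  have row: "\<beta> * b $ i \<le> (W *v y) $ i" for i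
  proof -
    have "0 \<le> a \<bullet> (row i W, b $ i)" by (rule pos) (simp add: G_def)
    then show ?thesis
      by (simp add: y \<beta>_def inner_vec_def matrix_vector_mult_def row_def mult.commute)
  qed
  have c: "c \<bullet> y < \<beta> * w"
    using a(1) \<open>k < 0\<close> by (simp add: y \<beta>_def inner_commute mult.commute)
  show ?thesis
  proof (cases "\<beta> = 0")
    \<comment> \<open>A degenerate separation would make \<open>y\<close> a direction with
      \<open>0 \<le> W *v y\<close> and \<open>c \<bullet> y < 0\<close>, which the dual feasible
      point \<open>p0\<close> excludes.\<close>
    case True
    have "c \<bullet> y = (W *v y) \<bullet> p0"
      by (simp only: p0(2) transpose_mult_inner)
    moreover have "0 \<bullet> p0 \<le> (W *v y) \<bullet> p0"
      by (rule inner_nonneg_mono) (use p0 row True in \<open>auto simp: less_eq_vec_def\<close>)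
    ultimately show ?thesis using c True by simp
  next
    case False
    then have "0 < \<beta>" using \<open>0 \<le> \<beta>\<close> by simp
    have "b \<le> W *v ((1 / \<beta>) *\<^sub>R y)"
      using row \<open>0 < \<beta>\<close> by (simp add: less_eq_vec_def matrix_vector_mult_scaleR field_simps)
    moreover have "c \<bullet> ((1 / \<beta>) *\<^sub>R y) < w"
      using c \<open>0 < \<beta>\<close> by (simp add: field_simps)
    ultimately show ?thesis by (intro exI[of _ "(1 / \<beta>) *\<^sub>R y"] conjI)
  qed
qed

text \<open>Strong linear programming duality at a support point. Expensive recourse supplies the
  dual feasible point, and the slack block of a dual pair is determined by \<open>\<xi>\<close>, so
  the bound covers all dual variables of the recourse problem.\<close>

lemma recourse_le:
  assumes "sufficiently_expensive_recourse D" "\<xi> \<in> support D"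
    and ub: "\<And>p. (\<xi>, p) \<in> dual_pairs D \<Longrightarrow> payoff D 0 x (\<xi>, p) \<le> v"
  shows "recourse D x \<xi> \<le> ereal v"
proof (rule ereal_le_epsilon2)
  fix e :: real assume "0 < e"
  obtain p0 where p0: "0 \<le> p0" "Qmat D *v \<xi> + qvec D = transpose (Wmat D) *v p0"
    using assms(1,2) unfolding sufficiently_expensive_recourse_def by blast
  have "(Tmap D x *v \<xi> + hmap D x) \<bullet> p \<le> v"
    if "0 \<le> p" "Qmat D *v \<xi> + qvec D = transpose (Wmat D) *v p" for p
    using ub[of "stack p (tvec D - Smat D *v \<xi>)"] that assms(2)
    by (simp add: dual_pairs_stack_iff payoff_stack)
  from linear_program_duality[OF p0 this, of "v + e"] \<open>0 < e\<close>
  obtain y where "Tmap D x *v \<xi> + hmap D x \<le> Wmat D *v y" "(Qmat D *v \<xi> + qvec D) \<bullet> y < v + e"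
    by auto
  then have "recourse D x \<xi> \<le> ereal ((Qmat D *v \<xi> + qvec D) \<bullet> y)" "(Qmat D *v \<xi> + qvec D) \<bullet> y \<le> v + e"
    unfolding recourse_def by (auto intro!: Inf_lower)
  then show "recourse D x \<xi> \<le> ereal v + ereal e"
    by (metis ereal_less_eq(3) order_trans plus_ereal.simps(1))
qed

section \<open>Measurability of the recourse function\<close>

text \<open>A strict sublevel set is a projection of pairs of scenario and feasible decision.
  Cutting with balls and with rational levels writes it as a countable union of projections of
  compact sets.\<close>

lemma borel_measurable_recourse: "recourse D x \<in> borel_measurable (restrict_space borel (support D))"
proof (rule measurable_restrict_space1, rule borel_measurableI_less)
  fix a :: ereal
  define K where "K n r = cball 0 (real n) \<inter>
    {(\<xi>, y). Tmap D x *v \<xi> + hmap D x \<le> Wmat D *v y \<and> (Qmat D *v \<xi> + qvec D) \<bullet> y \<le> r}" for n :: nat and r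
  have "compact (K n r)" for n r
  proof -
    have eq: "{(\<xi>, y). Tmap D x *v \<xi> + hmap D x \<le> Wmat D *v y \<and> (Qmat D *v \<xi> + qvec D) \<bullet> y \<le> r} =
      {z. (\<forall>i. (Tmap D x *v fst z + hmap D x) $ i \<le> (Wmat D *v snd z) $ i) \<and>
        (Qmat D *v fst z + qvec D) \<bullet> snd z \<le> r}"
      by (auto simp: less_eq_vec_def)
    show ?thesis
      unfolding K_def eq
      by (intro compact_Int_closed compact_cball closed_Collect_conj closed_Collect_all closed_Collect_le
          continuous_intros continuous_on_component)
  qed
  then have "compact (fst ` K n r)" for n r
    by (rule compact_continuous_image[rotated]) (intro continuous_intros)
  then have meas: "fst ` K n r \<in> sets borel" for n r
    by (rule borel_compact)
  have "{\<xi> \<in> space borel. recourse D x \<xi> < a} = (\<Union>r\<in>{r\<in>\<rat>. ereal r < a}. \<Union>n. fst ` K n r)"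
  proof safe
    fix \<xi> assume "recourse D x \<xi> < a"
    then obtain y where y: "Tmap D x *v \<xi> + hmap D x \<le> Wmat D *v y"
        "ereal ((Qmat D *v \<xi> + qvec D) \<bullet> y) < a"
      unfolding recourse_def Inf_less_iff by blast
    obtain r where r: "r \<in> \<rat>" "(Qmat D *v \<xi> + qvec D) \<bullet> y \<le> r" "ereal r < a"
    proof -
      obtain r' where "ereal ((Qmat D *v \<xi> + qvec D) \<bullet> y) < ereal r'" "ereal r' < a"
        using ereal_dense2[OF y(2)] by blast
      moreover then obtain r where "r \<in> \<rat>" "(Qmat D *v \<xi> + qvec D) \<bullet> y < r" "r < r'"
        using Rats_dense_in_real by auto
      ultimately show thesis
        by (intro that[of r]) (auto intro: order.strict_trans[of "ereal r" "ereal r'" a])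
    qed
    obtain n where "norm (\<xi>, y) \<le> real n" using real_arch_simple by blast
    then have "(\<xi>, y) \<in> K n r" using y r by (simp add: K_def del: mem_cball)
    then show "\<xi> \<in> (\<Union>r\<in>{r\<in>\<rat>. ereal r < a}. \<Union>n. fst ` K n r)"
      using r by force
  next
    fix \<xi> r n y assume "ereal r < a" "(\<xi>, y) \<in> K n r"
    then have "recourse D x \<xi> \<le> ereal ((Qmat D *v \<xi> + qvec D) \<bullet> y)" "(Qmat D *v \<xi> + qvec D) \<bullet> y \<le> r"
      unfolding recourse_def by (auto simp: K_def intro!: Inf_lower)
    then show "recourse D x (fst (\<xi>, y)) < a"
      using \<open>ereal r < a\<close> by (metis ereal_less_eq(3) fst_conv order_le_less_trans)
  qed simp
  also have "\<dots> \<in> sets borel"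
    by (intro sets.countable_UN' countable_subset[OF _ countable_rat]) (auto intro!: meas)
  finally show "{\<xi> \<in> space borel. recourse D x \<xi> < a} \<in> sets borel" .
qed

text \<open>Pairing \<open>W\<^sup>T p1 = 0\<close> with a decision \<open>y\<close> such that
  \<open>W y > 0\<close> gives a vanishing sum of nonnegative products, so each entry of
  \<open>p1\<close> is zero. The lower block of the equation reads \<open>- p2 = 0\<close>.\<close>

lemma extW_kernel_zero:
  assumes "complete_recourse D" "0 \<le> p" "transpose (extW D) *v p = 0"
  shows "p = 0"
proof -
  obtain p1 p2 where p: "p = stack p1 p2" by (rule stack_cases)
  obtain y where y: "\<And>i. 0 < (Wmat D *v y) $ i"
    using assms(1) unfolding complete_recourse_def by blast
  have p': "transpose (Wmat D) *v p1 = 0" "p2 = 0" "0 \<le> p1"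
    using assms(2,3) unfolding p transpose_extW_mult by (auto simp: vec_eq_iff stack_def all_sum less_eq_vec_def)
  have "(\<Sum>i\<in>UNIV. (Wmat D *v y) $ i * p1 $ i) = (transpose (Wmat D) *v p1) \<bullet> y"
    unfolding transpose_mult_inner by (simp add: inner_vec_def)
  then have "\<forall>i\<in>UNIV. (Wmat D *v y) $ i * p1 $ i = 0"
    using p' y by (subst sum_nonneg_eq_0_iff[symmetric]) (auto simp: less_eq_vec_def less_imp_le)
  then have "p1 = 0" using y by (auto simp: vec_eq_iff) (metis less_irrefl)
  then show ?thesis using p' p by (auto simp: vec_eq_iff stack_def all_sum)
qed

section \<open>Positivity of the homogenized gap\<close>

lemma hom_gap_1: "hom_gap D \<delta> x lam a \<theta> (\<xi>, p, 1) = \<theta> + lam * (norm (\<xi> - a))\<^sup>2 - payoff D \<delta> x (\<xi>, p)"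
  by (simp add: hom_gap_def payoff_def)

lemma dual_pairs_normalize:
  assumes "(\<xi>, p, \<tau>) \<in> conic_cone" "resid D (\<xi>, p, \<tau>) = 0" "0 < \<tau>"
  shows "((1 / \<tau>) *\<^sub>R \<xi>, (1 / \<tau>) *\<^sub>R p) \<in> dual_pairs D"
    and "hom_gap D \<delta> x lam a \<theta> (\<xi>, p, \<tau>) =
      \<tau>\<^sup>2 * hom_gap D \<delta> x lam a \<theta> ((1 / \<tau>) *\<^sub>R \<xi>, (1 / \<tau>) *\<^sub>R p, 1)"
proof -
  have z: "(\<xi>, p, \<tau>) = \<tau> *\<^sub>R ((1 / \<tau>) *\<^sub>R \<xi>, (1 / \<tau>) *\<^sub>R p, 1)"
    using assms(3) by simp
  show "hom_gap D \<delta> x lam a \<theta> (\<xi>, p, \<tau>) =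
      \<tau>\<^sup>2 * hom_gap D \<delta> x lam a \<theta> ((1 / \<tau>) *\<^sub>R \<xi>, (1 / \<tau>) *\<^sub>R p, 1)"
    by (subst z, subst hom_gap_scaleR) simp
  have "resid D ((1 / \<tau>) *\<^sub>R \<xi>, (1 / \<tau>) *\<^sub>R p, 1) = 0"
    using assms(2,3) unfolding z resid_scaleR by simp
  then show "((1 / \<tau>) *\<^sub>R \<xi>, (1 / \<tau>) *\<^sub>R p) \<in> dual_pairs D"
    using assms(1,3) by (auto simp: dual_pairs_def resid_def conic_cone_def less_eq_vec_def)
qed

text \<open>Directions of recession, where \<open>\<tau> = 0\<close>, are limits of points with \<open>\<tau> > 0\<close>.\<close>

lemma hom_gap_nonneg:
  assumes ub: "\<And>\<xi> p. (\<xi>, p) \<in> dual_pairs D \<Longrightarrow> payoff D \<delta> x (\<xi>, p) - lam * (norm (\<xi> - a))\<^sup>2 \<le> \<theta>"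
    and "dual_pairs D \<noteq> {}" and z: "z \<in> conic_cone" "resid D z = 0"
  shows "0 \<le> hom_gap D \<delta> x lam a \<theta> z"
proof -
  have pos: "0 \<le> hom_gap D \<delta> x lam a \<theta> w" if w: "w \<in> conic_cone" "resid D w = 0" "0 < snd (snd w)" for w
  proof (cases w)
    case (fields \<xi> p \<tau>)
    have "(\<xi>, p, \<tau>) \<in> conic_cone" "resid D (\<xi>, p, \<tau>) = 0" "0 < \<tau>"
      using w by (auto simp: fields)
    note n = dual_pairs_normalize[OF this]
    show ?thesis
      unfolding fields n(2) using ub[OF n(1)] by (simp add: hom_gap_1)
  qed
  obtain \<xi>0 p0 where w0: "(\<xi>0, p0) \<in> dual_pairs D" using assms(2) by auto
  \<comment> \<open>By linearity, adding a multiple of a dual pair keeps the residual zero while it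
    makes the last coordinate positive.\<close>
  define w where "w s = z + s *\<^sub>R (\<xi>0, p0, 1 :: real)" for s
  have "w 0 = z" by (simp add: w_def zero_prod_def)
  have "0 \<le> hom_gap D \<delta> x lam a \<theta> (w s)" if "0 < s" for s
  proof (rule pos)
    obtain \<xi> p \<tau> where zz: "z = (\<xi>, p, \<tau>)" by (cases z)
    show "w s \<in> conic_cone" "0 < snd (snd (w s))"
      using that z w0 by (auto simp: w_def zz conic_cone_def dual_pairs_def less_eq_vec_def)
    have "resid D (w s) = resid D z + s *\<^sub>R resid D (\<xi>0, p0, 1)"
      by (simp add: w_def zz resid_def matrix_vector_right_distrib matrix_vector_mult_scaleR
          algebra_simps del: transpose_matrix_vector)
    also have "\<dots> = 0"
      using z w0 by (simp add: resid_def dual_pairs_def)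
    finally show "resid D (w s) = 0" .
  qed
  then have "eventually (\<lambda>s. 0 \<le> hom_gap D \<delta> x lam a \<theta> (w s)) (at_right 0)"
    by (simp add: eventually_at_filter)
  moreover have "((\<lambda>s. hom_gap D \<delta> x lam a \<theta> (w s)) \<longlongrightarrow> hom_gap D \<delta> x lam a \<theta> (w 0)) (at_right 0)"
  proof -
    have "continuous_on UNIV w" unfolding w_def by (intro continuous_intros)
    then have "continuous_on UNIV (\<lambda>s. hom_gap D \<delta> x lam a \<theta> (w s))"
      using continuous_on_compose2[OF continuous_hom_gap] by blast
    then show ?thesis
      by (simp add: continuous_on_eq_continuous_at isCont_def filterlim_at_split)
  qed
  ultimately show ?thesis
    using tendsto_lowerbound[of "\<lambda>s. hom_gap D \<delta> x lam a \<theta> (w s)" "hom_gap D \<delta> x lam a \<theta> (w 0)" "at_right 0" 0]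
    by (simp only: trivial_limit_at_right_real not_False_eq_True \<open>w 0 = z\<close>)
qed

text \<open>At \<open>\<xi> = 0\<close> and \<open>\<tau> = 0\<close> the gap is
  \<open>\<delta> |p|\<^sup>2\<close>. For \<open>\<delta> = 0\<close> complete recourse leaves no
  nonzero \<open>p\<close> with vanishing residual.\<close>

lemma hom_gap_pos_kernel:
  assumes "0 < \<delta> \<or> \<delta> = 0 \<and> complete_recourse D"
    and "(0, p, 0) \<in> conic_cone" "resid D (0, p, 0) = 0" "p \<noteq> 0"
  shows "0 < hom_gap D \<delta> x lam a \<theta> (0, p, 0)"
  using assms extW_kernel_zero[of D p] by (auto simp: conic_cone_def hom_gap_def resid_def)

text \<open>Raising both \<open>lam\<close> and \<open>\<theta>\<close> by \<open>\<eta>\<close>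
  adds \<open>\<eta> (|\<xi> - \<tau> a|\<^sup>2 + \<tau>\<^sup>2)\<close> to a gap that is already
  nonnegative. The addition is positive unless \<open>\<xi>\<close> and \<open>\<tau>\<close> both
  vanish, and the kernel lemma covers that case.\<close>

lemma hom_gap_pos:
  assumes reg: "0 < \<delta> \<or> \<delta> = 0 \<and> complete_recourse D"
    and ub: "\<And>\<xi> p. (\<xi>, p) \<in> dual_pairs D \<Longrightarrow> payoff D \<delta> x (\<xi>, p) - lam * (norm (\<xi> - a))\<^sup>2 \<le> \<theta>"
    and "dual_pairs D \<noteq> {}" and z: "z \<in> conic_cone" "resid D z = 0" "z \<noteq> 0" and "0 < \<eta>"
  shows "0 < hom_gap D \<delta> x (lam + \<eta>) a (\<theta> + \<eta>) z"
proof (cases z)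
  case (fields \<xi> p \<tau>)
  have ge: "0 \<le> hom_gap D \<delta> x lam a \<theta> z"
    using hom_gap_nonneg assms by blast
  have eq: "hom_gap D \<delta> x (lam + \<eta>) a (\<theta> + \<eta>) z
      = hom_gap D \<delta> x lam a \<theta> z + \<eta> * ((norm (\<xi> - \<tau> *\<^sub>R a))\<^sup>2 + \<tau>\<^sup>2)"
    by (simp add: fields hom_gap_def algebra_simps)
  show ?thesis
  proof (cases "\<tau> = 0 \<and> \<xi> = 0")
    case True
    then show ?thesis
      using hom_gap_pos_kernel[OF reg] z by (auto simp: fields zero_prod_def)
  next
    case False
    then have "0 < (norm (\<xi> - \<tau> *\<^sub>R a))\<^sup>2 + \<tau>\<^sup>2"
      by (cases "\<tau> = 0") (auto intro: add_nonneg_pos)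
    then show ?thesis
      unfolding eq using ge \<open>0 < \<eta>\<close> by (simp add: add_nonneg_pos)
  qed
qed

text \<open>The counterpart for radius zero. On the ray over \<open>a\<close> the transport term is
  absent, so strict bounds at the single scenario \<open>a\<close> suffice;
  \<open>\<tau> = 0\<close> forces \<open>\<xi> = 0\<close>.\<close>

lemma hom_gap_pos_at_center:
  assumes reg: "0 < \<delta> \<or> \<delta> = 0 \<and> complete_recourse D"
    and ub: "\<And>p. (a, p) \<in> dual_pairs D \<Longrightarrow> payoff D \<delta> x (a, p) < \<theta>"
    and z: "z \<in> conic_cone" "resid D z = 0" "z \<noteq> 0" "fst z = snd (snd z) *\<^sub>R a"
  shows "0 < hom_gap D \<delta> x 0 a \<theta> z"
proof (cases z)
  case (fields \<xi> p \<tau>)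
  show ?thesis
  proof (cases "\<tau> = 0")
    case True
    then show ?thesis
      using hom_gap_pos_kernel[OF reg] z by (auto simp: fields zero_prod_def)
  next
    case False
    then have "0 < \<tau>" using z by (auto simp: fields conic_cone_def)
    with z(1,2)[unfolded fields] have n:
      "((1 / \<tau>) *\<^sub>R \<xi>, (1 / \<tau>) *\<^sub>R p) \<in> dual_pairs D"
      "hom_gap D \<delta> x 0 a \<theta> z = \<tau>\<^sup>2 * hom_gap D \<delta> x 0 a \<theta> ((1 / \<tau>) *\<^sub>R \<xi>, (1 / \<tau>) *\<^sub>R p, 1)"
      unfolding fields by (rule dual_pairs_normalize)+
    have "(1 / \<tau>) *\<^sub>R \<xi> = a" using z(4) \<open>0 < \<tau>\<close> by (simp add: fields)
    with n ub[of "(1 / \<tau>) *\<^sub>R p"] \<open>0 < \<tau>\<close> show ?thesis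
      by (simp add: hom_gap_1)
  qed
qed

section \<open>Passage between Lagrangian certificates and the copositive program\<close>

text \<open>The samples are coupled only through \<open>lam\<close>, so matrix variables found
  separately for each sample assemble to a feasible point.\<close>

lemma cp_objective_le:
  assumes "x \<in> decisions D" "0 \<le> lam"
    and "\<And>i. i \<in> {1..nsamples D} \<Longrightarrow>
      \<exists>s \<psi> \<phi>. copositive (cp_matrix D \<delta> i x lam s \<psi> \<phi>) \<and> cp_term D i lam s \<psi> \<phi> = \<theta> i"
  shows "cp_objective D \<delta> x \<le>
    ereal (cost D \<bullet> x + ((radius D)\<^sup>2 * lam + (1 / real (nsamples D)) * (\<Sum>i\<in>{1..nsamples D}. \<theta> i)))"
proof -
  obtain s \<psi> \<phi> where *: "\<And>i. i \<in> {1..nsamples D} \<Longrightarrow>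
      copositive (cp_matrix D \<delta> i x lam (s i) (\<psi> i) (\<phi> i)) \<and> cp_term D i lam (s i) (\<psi> i) (\<phi> i) = \<theta> i"
    using assms(3) by metis
  then have "cp_feasible D \<delta> x lam s \<psi> \<phi>"
    using assms by (simp add: cp_feasible_def)
  moreover have "(\<Sum>i\<in>{1..nsamples D}. \<theta> i) = (\<Sum>i\<in>{1..nsamples D}. cp_term D i lam (s i) (\<psi> i) (\<phi> i))"
    using * by (intro sum.cong) auto
  then have "cp_cost D x lam s \<psi> \<phi>
      = cost D \<bullet> x + ((radius D)\<^sup>2 * lam + (1 / real (nsamples D)) * (\<Sum>i\<in>{1..nsamples D}. \<theta> i))"
    by (simp add: cp_cost_def cp_term_def)
  ultimately show ?thesis
    unfolding cp_objective_def by (intro Inf_lower) (metis (mono_tags, lifting) mem_Collect_eq)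
qed

text \<open>A feasible point is reduced to a Lagrangian certificate \<open>(lam, \<theta>)\<close>
  of the same cost; the matrix variables are eliminated, which later allows limits to be taken in
  finitely many real numbers.\<close>

lemma cp_feasible_bounds:
  assumes "cp_feasible D \<delta> x lam s \<psi> \<phi>"
  shows "\<exists>\<theta>. 0 \<le> lam \<and> (\<forall>i\<in>{1..nsamples D}. \<forall>\<xi> p. (\<xi>, p) \<in> dual_pairs D \<longrightarrow>
      payoff D \<delta> x (\<xi>, p) \<le> \<theta> i + lam * (norm (\<xi> - sample D i))\<^sup>2) \<and>
    cp_cost D x lam s \<psi> \<phi>
      = cost D \<bullet> x + ((radius D)\<^sup>2 * lam + (1 / real (nsamples D)) * (\<Sum>i\<in>{1..nsamples D}. \<theta> i))"
proof (intro exI conjI ballI allI impI)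
  show "0 \<le> lam" using assms by (simp add: cp_feasible_def)
  show "cp_cost D x lam s \<psi> \<phi> = cost D \<bullet> x + ((radius D)\<^sup>2 * lam +
      (1 / real (nsamples D)) * (\<Sum>i\<in>{1..nsamples D}. cp_term D i lam (s i) (\<psi> i) (\<phi> i)))"
    by (simp add: cp_cost_def cp_term_def)
  fix i \<xi> p assume "i \<in> {1..nsamples D}" "(\<xi>, p) \<in> dual_pairs D"
  then show "payoff D \<delta> x (\<xi>, p) \<le> cp_term D i lam (s i) (\<psi> i) (\<phi> i) + lam * (norm (\<xi> - sample D i))\<^sup>2"
    using assms payoff_le_cp_term[of D \<delta> i x lam "s i" "\<psi> i" "\<phi> i" \<xi> p] by (auto simp: cp_feasible_def)
qed

lemma cp_value_eq_INF: "cp_value D \<delta> = (INF x\<in>decisions D. cp_objective D \<delta> x)"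
  unfolding cp_value_def cp_objective_def
proof (intro antisym INF_greatest Inf_greatest)
  fix x v assume "v \<in> {ereal (cp_cost D x lam s \<psi> \<phi>) |lam s \<psi> \<phi>. cp_feasible D \<delta> x lam s \<psi> \<phi>}"
  then show "Inf {ereal (cp_cost D x lam s \<psi> \<phi>) |x lam s \<psi> \<phi>. cp_feasible D \<delta> x lam s \<psi> \<phi>} \<le> v"
    by (intro Inf_lower) blast
next
  fix v assume "v \<in> {ereal (cp_cost D x lam s \<psi> \<phi>) |x lam s \<psi> \<phi>. cp_feasible D \<delta> x lam s \<psi> \<phi>}"
  then obtain x lam s \<psi> \<phi> where v: "v = ereal (cp_cost D x lam s \<psi> \<phi>)" "cp_feasible D \<delta> x lam s \<psi> \<phi>"
    by blast
  then have "x \<in> decisions D" by (simp add: cp_feasible_def)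
  then show "(INF x\<in>decisions D. Inf {ereal (cp_cost D x lam s \<psi> \<phi>) |lam s \<psi> \<phi>. cp_feasible D \<delta> x lam s \<psi> \<phi>}) \<le> v"
    using v by (intro INF_lower2[of x] Inf_lower) auto
qed

section \<open>Expectations and couplings\<close>

text \<open>Positive parts compare in one direction and negative parts in the other. Both parts of
  \<open>U\<close> have finite integrals, so the difference of the two bounds is the integral of
  \<open>U\<close>.\<close>

lemma ext_expectation_le_integral:
  assumes "integrable R U" "AE \<omega> in R. f \<omega> \<le> ereal (U \<omega>)"
  shows "ext_expectation R f \<le> ereal (\<integral>\<omega>. U \<omega> \<partial>R)"
proof -
  obtain r q where rq: "0 \<le> r" "0 \<le> q" "(\<integral>\<^sup>+\<omega>. ennreal (U \<omega>) \<partial>R) = ennreal r"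
      "(\<integral>\<^sup>+\<omega>. ennreal (- U \<omega>) \<partial>R) = ennreal q" "integral\<^sup>L R U = r - q"
    using assms(1) by (rule integrableE)
  have "(\<integral>\<^sup>+\<omega>. e2ennreal (f \<omega>) \<partial>R) \<le> ennreal r"
    unfolding rq(3)[symmetric] using assms(2)
    by (intro nn_integral_mono_AE, elim eventually_mono) (metis e2ennreal_mono e2ennreal_ereal)
  moreover have "ennreal q \<le> (\<integral>\<^sup>+\<omega>. e2ennreal (- f \<omega>) \<partial>R)"
    unfolding rq(4)[symmetric] using assms(2)
    by (intro nn_integral_mono_AE, elim eventually_mono) (metis e2ennreal_mono e2ennreal_ereal ereal_minus_le_minus uminus_ereal.simps(1))
  ultimately have "ext_expectation R f \<le> enn2ereal (ennreal r) - enn2ereal (ennreal q)"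
    unfolding ext_expectation_def by (intro ereal_minus_mono) (simp_all add: less_eq_ennreal.rep_eq)
  then show ?thesis using rq by (simp add: enn2ereal_ennreal)
qed

lemma integral_le_ext_expectation:
  assumes "integrable R U" "AE \<omega> in R. ereal (U \<omega>) \<le> f \<omega>"
  shows "ereal (\<integral>\<omega>. U \<omega> \<partial>R) \<le> ext_expectation R f"
proof -
  obtain r q where rq: "0 \<le> r" "0 \<le> q" "(\<integral>\<^sup>+\<omega>. ennreal (U \<omega>) \<partial>R) = ennreal r"
      "(\<integral>\<^sup>+\<omega>. ennreal (- U \<omega>) \<partial>R) = ennreal q" "integral\<^sup>L R U = r - q"
    using assms(1) by (rule integrableE)
  have "ennreal r \<le> (\<integral>\<^sup>+\<omega>. e2ennreal (f \<omega>) \<partial>R)"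
    unfolding rq(3)[symmetric] using assms(2)
    by (intro nn_integral_mono_AE, elim eventually_mono) (metis e2ennreal_mono e2ennreal_ereal)
  moreover have "(\<integral>\<^sup>+\<omega>. e2ennreal (- f \<omega>) \<partial>R) \<le> ennreal q"
    unfolding rq(4)[symmetric] using assms(2)
    by (intro nn_integral_mono_AE, elim eventually_mono) (metis e2ennreal_mono e2ennreal_ereal ereal_minus_le_minus uminus_ereal.simps(1))
  ultimately have "enn2ereal (ennreal r) - enn2ereal (ennreal q) \<le> ext_expectation R f"
    unfolding ext_expectation_def by (intro ereal_minus_mono) (simp_all add: less_eq_ennreal.rep_eq)
  then show ?thesis using rq by (simp add: enn2ereal_ennreal)
qed

lemma ext_expectation_distr:
  assumes [measurable]: "g \<in> measurable M N" "f \<in> borel_measurable N"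
  shows "ext_expectation (distr M N g) f = ext_expectation M (\<lambda>\<omega>. f (g \<omega>))"
  unfolding ext_expectation_def by (simp add: nn_integral_distr)

lemma (in prob_space) distr_pair_snd:
  assumes "prob_space N"
  shows "distr (N \<Otimes>\<^sub>M M) M snd = M"
proof (rule measure_eqI)
  interpret N: prob_space N by fact
  fix A assume "A \<in> sets (distr (N \<Otimes>\<^sub>M M) M snd)"
  then have A: "A \<in> sets M" by simp
  have "snd -` A \<inter> space (N \<Otimes>\<^sub>M M) = space N \<times> A"
    using sets.sets_into_space[OF A] by (auto simp: space_pair_measure)
  then show "emeasure (distr (N \<Otimes>\<^sub>M M) M snd) A = emeasure M A"
    using A by (simp add: emeasure_distr emeasure_pair_measure_Times N.emeasure_space_1)
qed simp

section \<open>The empirical distribution and its couplings\<close>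

context
  fixes D :: "('n1::finite, 'n2::finite, 'm::finite, 'k::finite, 'j::finite) dro_data"
  assumes samples: "1 \<le> nsamples D" "\<forall>i\<in>{1..nsamples D}. sample D i \<in> support D"
begin

lemma sample_measurable:
  "sample D \<in> uniform_count_measure {1..nsamples D} \<rightarrow>\<^sub>M restrict_space borel (support D)"
  using samples by (auto simp: measurable_def space_restrict_space sets_uniform_count_measure
      space_uniform_count_measure)

lemma prob_space_empirical: "prob_space (empirical D)"
  unfolding empirical_def
  by (rule prob_space.prob_space_distr[OF prob_space_uniform_count_measure sample_measurable])
    (use samples in auto)

lemma sets_empirical [measurable_cong]: "sets (empirical D) = sets (restrict_space borel (support D))"
  by (simp add: empirical_def)

lemma empirical_integral:
  assumes "g \<in> borel_measurable (restrict_space borel (support D))"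
  shows "integrable (empirical D) (g :: _ \<Rightarrow> real)"
    and "(\<integral>\<xi>. g \<xi> \<partial>empirical D) = (1 / real (nsamples D)) * (\<Sum>i\<in>{1..nsamples D}. g (sample D i))"
proof -
  show "integrable (empirical D) g"
    unfolding empirical_def
    by (subst integrable_distr_eq[OF sample_measurable assms])
      (simp add: uniform_count_measure_def integrable_point_measure_finite)
  show "(\<integral>\<xi>. g \<xi> \<partial>empirical D) = (1 / real (nsamples D)) * (\<Sum>i\<in>{1..nsamples D}. g (sample D i))"
    unfolding empirical_def
    by (subst integral_distr[OF sample_measurable assms]) (simp add: integral_uniform_count_measure)
qed

lemma AE_empirical: "AE \<xi> in empirical D. \<xi> \<in> sample D ` {1..nsamples D}"
proof -
  have "{\<xi> \<in> space (restrict_space borel (support D)). \<xi> \<in> sample D ` {1..nsamples D}}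
      \<in> sets (restrict_space borel (support D))"
  proof -
    have "{\<xi> \<in> space (restrict_space borel (support D)). \<xi> \<in> sample D ` {1..nsamples D}}
        = support D \<inter> sample D ` {1..nsamples D}"
      by (auto simp: space_restrict_space)
    also have "\<dots> \<in> sets (restrict_space borel (support D))"
      unfolding sets_restrict_space by (intro imageI borel_closed finite_imp_closed) simp
    finally show ?thesis .
  qed
  then show ?thesis
    unfolding empirical_def
    by (subst AE_distr_iff[OF sample_measurable]) (auto intro!: AE_I2 simp: space_uniform_count_measure)
qed

text \<open>The definition of the distance as an infimum yields a coupling within any tolerance,
  which avoids the existence of an optimal one. Its squared cost is integrable because both
  marginals have second moments.\<close>

lemma near_optimal_coupling:
  assumes P: "P \<in> ambiguity_set D" and "0 < e"
  obtains R where "R \<in> couplings P (empirical D)"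
    "integrable R (\<lambda>\<omega>. (norm (fst \<omega> - snd \<omega>))\<^sup>2)" "(\<integral>\<omega>. (norm (fst \<omega> - snd \<omega>))\<^sup>2 \<partial>R) \<le> (radius D + e)\<^sup>2"
proof -
  have P': "prob_space P" "sets P = sets (restrict_space borel (support D))"
      "integrable P (\<lambda>\<xi>. (norm \<xi>)\<^sup>2)" "wasserstein2 P (empirical D) \<le> radius D"
    using P by (auto simp: ambiguity_set_def distributions2_def)
  interpret P: prob_space P by fact
  interpret E: prob_space "empirical D" by (rule prob_space_empirical)
  interpret PE: pair_prob_space P "empirical D" ..
  \<comment> \<open>The product measure shows that the real infimum ranges over a nonempty set,
    without which nothing could be extracted from it.\<close>
  have "P \<Otimes>\<^sub>M empirical D \<in> couplings P (empirical D)"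
    unfolding couplings_def
    using E.distr_pair_fst[of P] E.distr_pair_snd[OF P'(1)] PE.P.prob_space_axioms by simp
  then have ne: "couplings P (empirical D) \<noteq> {}" by auto
  have "(INF R\<in>couplings P (empirical D). sqrt (\<integral>(\<xi>1, \<xi>2). (norm (\<xi>1 - \<xi>2))\<^sup>2 \<partial>R)) < radius D + e"
    using P'(4) \<open>0 < e\<close> unfolding wasserstein2_def by linarith
  then obtain R where R: "R \<in> couplings P (empirical D)"
      "sqrt (\<integral>(\<xi>1, \<xi>2). (norm (\<xi>1 - \<xi>2))\<^sup>2 \<partial>R) < radius D + e"
    using cInf_lessD[of "(\<lambda>R. sqrt (\<integral>(\<xi>1, \<xi>2). (norm (\<xi>1 - \<xi>2))\<^sup>2 \<partial>R)) ` couplings P (empirical D)"] ne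
    by auto
  have sq: "(\<integral>\<omega>. (norm (fst \<omega> - snd \<omega>))\<^sup>2 \<partial>R) \<le> (radius D + e)\<^sup>2"
    using R(2) by (intro sqrt_le_D) (simp add: case_prod_unfold)
  have sR [measurable_cong]: "sets R = sets (P \<Otimes>\<^sub>M empirical D)"
    and d: "distr R P fst = P" "distr R (empirical D) snd = empirical D"
    using R(1) by (auto simp: couplings_def)
  have [measurable_cong]: "sets P = sets (restrict_space borel (support D))" by fact
  have nm [measurable]: "(\<lambda>\<xi>. (norm \<xi>)\<^sup>2) \<in> borel_measurable (restrict_space borel (support D))"
    by (intro measurable_restrict_space1) simp
  have id [measurable]: "(\<lambda>\<xi>. \<xi>) \<in> restrict_space borel (support D) \<rightarrow>\<^sub>M borel"
    by (intro measurable_restrict_space1) simp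
  have m [measurable]: "fst \<in> R \<rightarrow>\<^sub>M P" "snd \<in> R \<rightarrow>\<^sub>M empirical D" by measurable
  have i1: "integrable R (\<lambda>\<omega>. (norm (fst \<omega>))\<^sup>2)"
    using P'(3) by (subst (asm) d(1)[symmetric], subst (asm) integrable_distr_eq) auto
  have i2: "integrable R (\<lambda>\<omega>. (norm (snd \<omega>))\<^sup>2)"
    using empirical_integral(1)[OF nm] by (subst (asm) d(2)[symmetric], subst (asm) integrable_distr_eq) auto
  have "integrable R (\<lambda>\<omega>. (norm (fst \<omega> - snd \<omega>))\<^sup>2)"
  proof (rule Bochner_Integration.integrable_bound)
    show "integrable R (\<lambda>\<omega>. 2 * (norm (fst \<omega>))\<^sup>2 + 2 * (norm (snd \<omega>))\<^sup>2)" using i1 i2 by simp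
    show "AE \<omega> in R. norm ((norm (fst \<omega> - snd \<omega>))\<^sup>2) \<le> norm (2 * (norm (fst \<omega>))\<^sup>2 + 2 * (norm (snd \<omega>))\<^sup>2)"
    proof (rule AE_I2)
      fix \<omega> :: "(real ^ 'k) \<times> (real ^ 'k)"
      have "(norm (fst \<omega> - snd \<omega>))\<^sup>2 \<le> (norm (fst \<omega>) + norm (snd \<omega>))\<^sup>2"
        by (intro power_mono norm_triangle_ineq4) auto
      also have "\<dots> \<le> 2 * (norm (fst \<omega>))\<^sup>2 + 2 * (norm (snd \<omega>))\<^sup>2"
        using sum_squares_bound[of "norm (fst \<omega>)" "norm (snd \<omega>)"] by (simp add: power2_sum)
      finally show "norm ((norm (fst \<omega> - snd \<omega>))\<^sup>2) \<le> norm (2 * (norm (fst \<omega>))\<^sup>2 + 2 * (norm (snd \<omega>))\<^sup>2)"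
        by simp
    qed
    show "(\<lambda>\<omega>. (norm (fst \<omega> - snd \<omega>))\<^sup>2) \<in> borel_measurable R" by measurable
  qed
  then show thesis using that R(1) sq by blast
qed

section \<open>Weak duality over the Wasserstein ball\<close>

text \<open>The pointwise bound is integrated against a nearly optimal coupling, whose second
  coordinate is almost surely a sample, and the tolerance then tends to zero.\<close>

lemma ext_expectation_le_dual:
  assumes P: "P \<in> ambiguity_set D" and "0 \<le> lam"
    and ub: "AE \<xi> in P. \<forall>i\<in>{1..nsamples D}. recourse D x \<xi> \<le> ereal (\<theta> i + lam * (norm (\<xi> - sample D i))\<^sup>2)"
  shows "ext_expectation P (recourse D x)
    \<le> ereal ((radius D)\<^sup>2 * lam + (1 / real (nsamples D)) * (\<Sum>i\<in>{1..nsamples D}. \<theta> i))"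
proof -
  let ?S = "sample D ` {1..nsamples D}"
  \<comment> \<open>Several indices may share one sample point, while the coupling only sees points.
    The least \<open>\<theta>\<close> over these indices is a function of the point, is a valid
    bound, and does not increase the average.\<close>
  define m where "m a = Min (\<theta> ` {i \<in> {1..nsamples D}. sample D i = a})" for a
  define g where "g \<xi> = (\<Sum>a\<in>?S. m a * indicator {a} \<xi>)" for \<xi>
  have g: "g a = m a" if "a \<in> ?S" for a
  proof -
    have "g a = (\<Sum>b\<in>?S. if b = a then m b else 0)"
      unfolding g_def by (intro sum.cong) (auto simp: indicator_def)
    then show ?thesis using that by (simp add: sum.delta)
  qed
  have m_le: "m (sample D i) \<le> \<theta> i" if "i \<in> {1..nsamples D}" for i
    using that unfolding m_def by (intro Min_le) auto
  have m_in: "\<exists>i\<in>{1..nsamples D}. sample D i = a \<and> m a = \<theta> i" if "a \<in> ?S" for a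
  proof -
    have "m a \<in> \<theta> ` {i \<in> {1..nsamples D}. sample D i = a}"
      unfolding m_def using that by (intro Min_in) auto
    then show ?thesis by auto
  qed
  have meas_g: "g \<in> borel_measurable (restrict_space borel (support D))"
    unfolding g_def by (intro measurable_restrict_space1) measurable
  have bound: "ext_expectation P (recourse D x)
    \<le> ereal ((radius D + e)\<^sup>2 * lam + (1 / real (nsamples D)) * (\<Sum>i\<in>{1..nsamples D}. \<theta> i))" if "0 < e" for e
  proof -
    obtain R where R: "R \<in> couplings P (empirical D)"
      "integrable R (\<lambda>\<omega>. (norm (fst \<omega> - snd \<omega>))\<^sup>2)" "(\<integral>\<omega>. (norm (fst \<omega> - snd \<omega>))\<^sup>2 \<partial>R) \<le> (radius D + e)\<^sup>2"
      using near_optimal_coupling[OF P \<open>0 < e\<close>] by blast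
    have sR [measurable_cong]: "sets R = sets (P \<Otimes>\<^sub>M empirical D)"
      and d: "distr R P fst = P" "distr R (empirical D) snd = empirical D"
      using R(1) by (auto simp: couplings_def)
    have m [measurable]: "fst \<in> R \<rightarrow>\<^sub>M P" "snd \<in> R \<rightarrow>\<^sub>M empirical D" by measurable
    have sP: "sets P = sets (restrict_space borel (support D))"
      using P by (auto simp: ambiguity_set_def distributions2_def)
    have mg [measurable]: "g \<in> borel_measurable (empirical D)"
      using meas_g by (simp add: measurable_cong_sets[OF sets_empirical refl])
    have mr: "recourse D x \<in> borel_measurable P"
      using borel_measurable_recourse by (simp add: measurable_cong_sets[OF sP refl])
    have ig: "integrable R (\<lambda>\<omega>. g (snd \<omega>))" "(\<integral>\<omega>. g (snd \<omega>) \<partial>R) = (\<integral>\<xi>. g \<xi> \<partial>empirical D)"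
      using empirical_integral(1)[OF meas_g] integrable_distr_eq[OF m(2) mg] integral_distr[OF m(2) mg]
      unfolding d by simp_all
    define U where "U \<omega> = g (snd \<omega>) + lam * (norm (fst \<omega> - snd \<omega>))\<^sup>2" for \<omega>
    have iU: "integrable R U" unfolding U_def using ig R(2) by simp
    have "AE \<omega> in R. \<forall>i\<in>{1..nsamples D}.
        recourse D x (fst \<omega>) \<le> ereal (\<theta> i + lam * (norm (fst \<omega> - sample D i))\<^sup>2)"
      by (rule AE_distrD[OF m(1)]) (simp only: d ub)
    moreover have "AE \<omega> in R. snd \<omega> \<in> ?S"
      by (rule AE_distrD[OF m(2)]) (simp only: d AE_empirical)
    ultimately have "AE \<omega> in R. recourse D x (fst \<omega>) \<le> ereal (U \<omega>)"
    proof eventually_elim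
      case (elim \<omega>)
      then obtain i where i: "i \<in> {1..nsamples D}" "sample D i = snd \<omega>" "m (snd \<omega>) = \<theta> i"
        using m_in by blast
      then have "recourse D x (fst \<omega>) \<le> ereal (\<theta> i + lam * (norm (fst \<omega> - sample D i))\<^sup>2)"
        using elim(1) by blast
      then show ?case using elim(2) i g[of "snd \<omega>"] by (simp add: U_def)
    qed
    from ext_expectation_le_integral[OF iU this]
    have "ext_expectation R (\<lambda>\<omega>. recourse D x (fst \<omega>)) \<le> ereal (\<integral>\<omega>. U \<omega> \<partial>R)" .
    also have "ext_expectation R (\<lambda>\<omega>. recourse D x (fst \<omega>)) = ext_expectation P (recourse D x)"
      using ext_expectation_distr[OF m(1) mr] by (simp add: d)
    also have "(\<integral>\<omega>. U \<omega> \<partial>R) \<le> (radius D + e)\<^sup>2 * lam + (1 / real (nsamples D)) * (\<Sum>i\<in>{1..nsamples D}. \<theta> i)"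
    proof -
      have "(\<integral>\<omega>. U \<omega> \<partial>R) = (1 / real (nsamples D)) * (\<Sum>i\<in>{1..nsamples D}. g (sample D i))
          + lam * (\<integral>\<omega>. (norm (fst \<omega> - snd \<omega>))\<^sup>2 \<partial>R)"
        unfolding U_def using ig R(2) empirical_integral(2)[OF meas_g] by simp
      moreover have "(1 / real (nsamples D)) * (\<Sum>i\<in>{1..nsamples D}. g (sample D i))
          \<le> (1 / real (nsamples D)) * (\<Sum>i\<in>{1..nsamples D}. \<theta> i)"
        by (intro mult_left_mono sum_mono) (use g m_le in auto)
      moreover have "lam * (\<integral>\<omega>. (norm (fst \<omega> - snd \<omega>))\<^sup>2 \<partial>R) \<le> (radius D + e)\<^sup>2 * lam"
        using R(3) \<open>0 \<le> lam\<close> by (simp add: mult.commute mult_left_mono)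
      ultimately show ?thesis by linarith
    qed
    finally show ?thesis by simp
  qed
  \<comment> \<open>The bound is continuous in the tolerance, so the inequality persists at
    \<open>e = 0\<close>.\<close>
  let ?B = "\<lambda>e. ereal ((radius D + e)\<^sup>2 * lam + (1 / real (nsamples D)) * (\<Sum>i\<in>{1..nsamples D}. \<theta> i))"
  have "(?B \<longlongrightarrow> ?B 0) (at_right 0)"
    by (intro tendsto_intros)
  moreover have "eventually (\<lambda>e. ext_expectation P (recourse D x) \<le> ?B e) (at_right 0)"
    using bound by (simp add: eventually_at_filter)
  ultimately have "ext_expectation P (recourse D x) \<le> ?B 0"
    by (intro tendsto_lowerbound) auto
  then show ?thesis by simp
qed

text \<open>The squared distance to the finite sample set is at most the transport cost under every
  coupling. Its expectation is therefore below every positive number, hence zero.\<close>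

lemma AE_sample_of_radius_zero:
  assumes P: "P \<in> ambiguity_set D" and "radius D = 0"
  shows "AE \<xi> in P. \<xi> \<in> sample D ` {1..nsamples D}"
proof -
  let ?S = "sample D ` {1..nsamples D}"
  have sP: "sets P = sets (restrict_space borel (support D))"
    using P by (auto simp: ambiguity_set_def distributions2_def)
  have mi: "(\<lambda>\<xi>. ennreal ((infdist \<xi> ?S)\<^sup>2)) \<in> borel_measurable P"
    unfolding measurable_cong_sets[OF sP refl]
    by (intro measurable_restrict_space1 measurable_compose[OF _ measurable_ennreal]
        borel_measurable_continuous_onI continuous_intros)
  have "(\<integral>\<^sup>+\<xi>. ennreal ((infdist \<xi> ?S)\<^sup>2) \<partial>P) \<le> ennreal e" if "0 < e" for e
  proof -
    obtain R where R: "R \<in> couplings P (empirical D)"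
      "integrable R (\<lambda>\<omega>. (norm (fst \<omega> - snd \<omega>))\<^sup>2)" "(\<integral>\<omega>. (norm (fst \<omega> - snd \<omega>))\<^sup>2 \<partial>R) \<le> (radius D + sqrt e)\<^sup>2"
      \<comment> \<open>With radius zero the tolerance \<open>sqrt e\<close> gives transport cost at
        most \<open>e\<close>.\<close>
      using near_optimal_coupling[OF P, of "sqrt e"] \<open>0 < e\<close> by auto
    have sR [measurable_cong]: "sets R = sets (P \<Otimes>\<^sub>M empirical D)"
      and d: "distr R P fst = P" "distr R (empirical D) snd = empirical D"
      using R(1) by (auto simp: couplings_def)
    have m [measurable]: "fst \<in> R \<rightarrow>\<^sub>M P" "snd \<in> R \<rightarrow>\<^sub>M empirical D" by measurable
    have S: "AE \<omega> in R. snd \<omega> \<in> ?S"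
      by (rule AE_distrD[OF m(2)]) (simp only: d AE_empirical)
    have "(\<integral>\<^sup>+\<xi>. ennreal ((infdist \<xi> ?S)\<^sup>2) \<partial>P) = (\<integral>\<^sup>+\<omega>. ennreal ((infdist (fst \<omega>) ?S)\<^sup>2) \<partial>R)"
      using nn_integral_distr[OF m(1), of "\<lambda>\<xi>. ennreal ((infdist \<xi> ?S)\<^sup>2)"] mi by (simp add: d)
    also have "\<dots> \<le> (\<integral>\<^sup>+\<omega>. ennreal ((norm (fst \<omega> - snd \<omega>))\<^sup>2) \<partial>R)"
      using S by (intro nn_integral_mono_AE, elim eventually_mono)
        (auto intro!: ennreal_leI power_mono infdist_le[THEN order_trans] infdist_nonneg simp: dist_norm)
    also have "\<dots> = ennreal (\<integral>\<omega>. (norm (fst \<omega> - snd \<omega>))\<^sup>2 \<partial>R)"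
      by (rule nn_integral_eq_integral[OF R(2)]) auto
    also have "\<dots> \<le> ennreal e"
      using R(3) assms(2) \<open>0 < e\<close> by (intro ennreal_leI) simp
    finally show ?thesis .
  qed
  then have "(\<integral>\<^sup>+\<xi>. ennreal ((infdist \<xi> ?S)\<^sup>2) \<partial>P) \<le> 0 + ennreal e" if "0 < e" for e
    using that by simp
  then have "(\<integral>\<^sup>+\<xi>. ennreal ((infdist \<xi> ?S)\<^sup>2) \<partial>P) \<le> 0"
    by (rule ennreal_le_epsilon)
  then have "AE \<xi> in P. ennreal ((infdist \<xi> ?S)\<^sup>2) = 0"
    using nn_integral_0_iff_AE[OF mi] by simp
  then show ?thesis
  proof eventually_elim
    case (elim \<xi>)
    then have "infdist \<xi> ?S = 0" by simp
    moreover have "closed ?S" "?S \<noteq> {}" using samples(1) by (auto intro: finite_imp_closed)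
    ultimately show ?case using in_closed_iff_infdist_zero by blast
  qed
qed

section \<open>Finitely supported members of the Wasserstein ball\<close>

text \<open>Almost surely \<open>f\<close> is the sample at the uniformly distributed index
  \<open>idx\<close>, so both measures count the indices whose sample lies in
  \<open>A\<close>.\<close>

lemma empirical_eq_distr_pmf:
  fixes R :: "'a pmf"
  assumes R: "map_pmf idx R = pmf_of_set {1..nsamples D}"
    and f: "f \<in> measure_pmf R \<rightarrow>\<^sub>M restrict_space borel (support D)"
    and eq: "\<And>a. idx a \<in> {1..nsamples D} \<Longrightarrow> f a = sample D (idx a)"
  shows "distr (measure_pmf R) (restrict_space borel (support D)) f = empirical D"
proof (rule measure_eqI)
  fix A assume "A \<in> sets (distr (measure_pmf R) (restrict_space borel (support D)) f)"
  then have A: "A \<in> sets (restrict_space borel (support D))" by simp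
  have idx: "AE a in measure_pmf R. idx a \<in> {1..nsamples D}"
  proof -
    have "idx ` set_pmf R = {1..nsamples D}"
      using arg_cong[OF R, of set_pmf] samples(1) by (simp add: set_pmf_of_set)
    then show ?thesis by (auto simp: AE_measure_pmf_iff)
  qed
  have "emeasure (distr (measure_pmf R) (restrict_space borel (support D)) f) A
      = emeasure (measure_pmf R) (f -` A)"
    using A f by (simp add: emeasure_distr)
  also have "\<dots> = emeasure (measure_pmf R) (idx -` (sample D -` A))"
    using idx by (intro emeasure_eq_AE, elim eventually_mono) (simp_all add: eq del: atLeastAtMost_iff)
  also have "\<dots> = emeasure (measure_pmf (pmf_of_set {1..nsamples D})) (sample D -` A)"
    by (simp only: R[symmetric] emeasure_map_pmf)
  also have "\<dots> = ennreal ((1 / real (nsamples D)) * (\<Sum>i\<in>{1..nsamples D}. indicator A (sample D i)))"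
  proof -
    have "(\<Sum>i\<in>{1..nsamples D}. indicator A (sample D i) :: real)
      = real (card ({1..nsamples D} \<inter> sample D -` A))"
      by (simp add: indicator_def sum.If_cases vimage_def Int_commute)
    then show ?thesis
      using samples(1) by (simp add: emeasure_pmf_of_set ennreal_of_nat_eq_real_of_nat divide_ennreal)
  qed
  also have "\<dots> = emeasure (empirical D) A"
    using emeasure_empirical[OF samples(2,1) A] by simp
  finally show "emeasure (distr (measure_pmf R) (restrict_space borel (support D)) f) A = emeasure (empirical D) A" .
qed (simp add: sets_empirical)

text \<open>The joint law of \<open>X\<close> and of the sample at \<open>idx\<close> is an explicit
  coupling of cost at most the squared radius. Hence the law of \<open>X\<close> belongs to the
  ambiguity set, and its expected recourse dominates that of \<open>V\<close>.\<close>

lemma pmf_expectation_le_worst_case: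
  fixes R :: "'a pmf" and X :: "'a \<Rightarrow> real ^ 'k"
  assumes fin: "finite (set_pmf R)"
    and V: "\<And>a. a \<in> set_pmf R \<Longrightarrow> X a \<in> support D \<and> ereal (V a) \<le> recourse D x (X a)"
    and R: "map_pmf idx R = pmf_of_set {1..nsamples D}"
    and "0 \<le> radius D"
    and d: "measure_pmf.expectation R (\<lambda>a. (norm (X a - sample D (idx a)))\<^sup>2) \<le> (radius D)\<^sup>2"
  shows "ereal (measure_pmf.expectation R V) \<le> worst_case D x"
proof -
  let ?B = "restrict_space borel (support D)"
  have sp: "sample D 1 \<in> support D" using samples by simp
  \<comment> \<open>Measurability into the restricted space requires values in the support
    everywhere, so \<open>X\<close> and the sample map are redefined outside the support of
    \<open>R\<close> by the default \<open>sample D 1\<close>.\<close>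
  define X' where "X' a = (if X a \<in> support D then X a else sample D 1)" for a
  define Y where "Y a = (if idx a \<in> {1..nsamples D} then sample D (idx a) else sample D 1)" for a
  have idx: "idx a \<in> {1..nsamples D}" if "a \<in> set_pmf R" for a
  proof -
    have "idx ` set_pmf R = {1..nsamples D}"
      using arg_cong[OF R, of set_pmf] samples(1) by (simp add: set_pmf_of_set)
    then show ?thesis using that by auto
  qed
  have mX [measurable]: "X' \<in> measure_pmf R \<rightarrow>\<^sub>M ?B"
    using sp by (simp add: X'_def space_restrict_space)
  have mY [measurable]: "Y \<in> measure_pmf R \<rightarrow>\<^sub>M ?B"
    using samples by (auto simp: Y_def sp space_restrict_space)
  have XX: "X' a = X a" "Y a = sample D (idx a)" if "a \<in> set_pmf R" for a
    using V[OF that] idx[OF that] by (auto simp: X'_def Y_def)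
  define P where "P = distr (measure_pmf R) ?B X'"
  have E: "distr (measure_pmf R) ?B Y = empirical D"
    by (rule empirical_eq_distr_pmf[OF R mY]) (simp add: Y_def)
  have sP [measurable_cong]: "sets P = sets ?B" by (simp add: P_def)
  have id [measurable]: "(\<lambda>\<xi>. \<xi>) \<in> ?B \<rightarrow>\<^sub>M borel"
    by (intro measurable_restrict_space1) simp
  have nm: "(\<lambda>\<xi>. (norm \<xi>)\<^sup>2) \<in> borel_measurable ?B"
    by measurable
  have "P \<in> distributions2 (support D)"
    unfolding distributions2_def
  proof (intro CollectI conjI)
    show "prob_space P"
      unfolding P_def by (rule measure_pmf.prob_space_distr[OF mX])
    show "sets P = sets ?B" by (rule sP)
    show "integrable P (\<lambda>\<xi>. (norm \<xi>)\<^sup>2)"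
      unfolding P_def by (subst integrable_distr_eq[OF mX nm]) (rule integrable_measure_pmf_finite[OF fin])
  qed
  moreover have "wasserstein2 P (empirical D) \<le> radius D"
  proof -
    define C where "C = distr (measure_pmf R) (P \<Otimes>\<^sub>M empirical D) (\<lambda>a. (X' a, Y a))"
    have mX' [measurable]: "X' \<in> measure_pmf R \<rightarrow>\<^sub>M P" and mY' [measurable]: "Y \<in> measure_pmf R \<rightarrow>\<^sub>M empirical D"
      using mX mY by (simp_all add: measurable_cong_sets[OF refl sP] measurable_cong_sets[OF refl sets_empirical])
    have mC: "(\<lambda>a. (X' a, Y a)) \<in> measure_pmf R \<rightarrow>\<^sub>M P \<Otimes>\<^sub>M empirical D" by measurable
    have "C \<in> couplings P (empirical D)"
      unfolding couplings_def
    proof (intro CollectI conjI)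
      show "prob_space C"
        unfolding C_def by (rule measure_pmf.prob_space_distr[OF mC])
      show "sets C = sets (P \<Otimes>\<^sub>M empirical D)" by (simp add: C_def)
      have "distr C P fst = distr (measure_pmf R) P X'"
        unfolding C_def by (subst distr_distr[OF _ mC]) (auto simp: comp_def)
      also have "\<dots> = P" unfolding P_def by (rule distr_cong) auto
      finally show "distr C P fst = P" .
      have "distr C (empirical D) snd = distr (measure_pmf R) (empirical D) Y"
        unfolding C_def by (subst distr_distr[OF _ mC]) (auto simp: comp_def)
      also have "\<dots> = distr (measure_pmf R) ?B Y" by (rule distr_cong) (auto simp: sets_empirical)
      finally show "distr C (empirical D) snd = empirical D" by (simp add: E)
    qed
    then have "wasserstein2 P (empirical D) \<le> sqrt (\<integral>(\<xi>1, \<xi>2). (norm (\<xi>1 - \<xi>2))\<^sup>2 \<partial>C)"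
      unfolding wasserstein2_def
      by (intro cINF_lower) (auto intro!: bdd_belowI[of _ 0] Bochner_Integration.integral_nonneg)
    also have "(\<integral>(\<xi>1, \<xi>2). (norm (\<xi>1 - \<xi>2))\<^sup>2 \<partial>C)
        = measure_pmf.expectation R (\<lambda>a. (norm (X' a - Y a))\<^sup>2)"
      unfolding C_def by (subst integral_distr[OF mC]) auto
    also have "\<dots> = measure_pmf.expectation R (\<lambda>a. (norm (X a - sample D (idx a)))\<^sup>2)"
      by (intro integral_cong_AE) (auto simp: AE_measure_pmf_iff XX)
    also have "sqrt \<dots> \<le> radius D"
      using d \<open>0 \<le> radius D\<close> by (simp add: real_le_lsqrt)
    finally show ?thesis by simp
  qed
  ultimately have PA: "P \<in> ambiguity_set D" by (simp add: ambiguity_set_def)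
  have "ereal (measure_pmf.expectation R V) \<le> ext_expectation (measure_pmf R) (\<lambda>a. recourse D x (X' a))"
    using V by (intro integral_le_ext_expectation integrable_measure_pmf_finite[OF fin])
      (auto simp: AE_measure_pmf_iff XX)
  also have "\<dots> = ext_expectation P (recourse D x)"
    unfolding P_def by (subst ext_expectation_distr[OF mX borel_measurable_recourse]) simp
  also have "\<dots> \<le> worst_case D x"
    unfolding worst_case_def by (rule SUP_upper[OF PA])
  finally show ?thesis .
qed

end

section \<open>Separation in the plane\<close>

text \<open>The supremum of a separable sum is the sum of the suprema. Each supremum is finite
  because the other coordinates can be frozen at \<open>w0\<close>.\<close>

lemma separable_sup:
  fixes u :: "nat \<Rightarrow> 'b \<Rightarrow> real"
  assumes "finite I" and ne: "\<And>i. i \<in> I \<Longrightarrow> \<Omega> i \<noteq> {}"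
    and ub: "\<And>w. (\<And>i. i \<in> I \<Longrightarrow> w i \<in> \<Omega> i) \<Longrightarrow> (\<Sum>i\<in>I. u i (w i)) \<le> C"
  shows "\<exists>\<theta>. (\<forall>i\<in>I. \<forall>w\<in>\<Omega> i. u i w \<le> \<theta> i) \<and> (\<Sum>i\<in>I. \<theta> i) \<le> C"
proof -
  obtain w0 where w0: "\<And>i. i \<in> I \<Longrightarrow> w0 i \<in> \<Omega> i"
    using bchoice[of I "\<lambda>i w. w \<in> \<Omega> i"] ne by blast
  define \<theta> where "\<theta> i = (SUP w\<in>\<Omega> i. u i w)" for i
  have bdd: "bdd_above (u i ` \<Omega> i)" if "i \<in> I" for i
  proof (rule bdd_aboveI2)
    fix w assume w: "w \<in> \<Omega> i"
    have "(\<Sum>j\<in>I. u j ((w0(i := w)) j)) \<le> C" using w0 w by (intro ub) auto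
    moreover have "(\<Sum>j\<in>I. u j ((w0(i := w)) j)) = u i w + (\<Sum>j\<in>I - {i}. u j (w0 j))"
      using assms(1) that by (subst sum.remove[of I i]) (auto intro!: sum.cong)
    ultimately show "u i w \<le> C - (\<Sum>j\<in>I - {i}. u j (w0 j))" by linarith
  qed
  have "(\<Sum>i\<in>I. \<theta> i) \<le> C + e" if "0 < e" for e
  proof -
    \<comment> \<open>The tolerance is shared among the indices; the added 1 keeps the denominator
      positive for empty \<open>I\<close>.\<close>
    define h where "h = e / (real (card I) + 1)"
    have "0 < h" using \<open>0 < e\<close> by (simp add: h_def)
    have "\<exists>w\<in>\<Omega> i. \<theta> i - h < u i w" if "i \<in> I" for i
      using less_cSUP_iff[OF ne bdd, OF that that, of "\<theta> i - h"] \<open>0 < h\<close> by (simp add: \<theta>_def)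
    then obtain w where w: "\<And>i. i \<in> I \<Longrightarrow> w i \<in> \<Omega> i \<and> \<theta> i - h < u i (w i)" by metis
    have "(\<Sum>i\<in>I. \<theta> i) \<le> (\<Sum>i\<in>I. u i (w i) + h)"
      using w by (intro sum_mono) (smt (verit))
    also have "\<dots> = (\<Sum>i\<in>I. u i (w i)) + real (card I) * h" by (simp add: sum.distrib)
    also have "\<dots> \<le> C + real (card I) * h" using ub[of w] w by simp
    also have "real (card I) * h \<le> e" using \<open>0 < e\<close> by (simp add: h_def field_simps)
    finally show ?thesis by simp
  qed
  then have "(\<Sum>i\<in>I. \<theta> i) \<le> C" by (rule field_le_epsilon)
  moreover have "\<forall>i\<in>I. \<forall>w\<in>\<Omega> i. u i w \<le> \<theta> i"
    unfolding \<theta>_def using bdd by (auto intro: cSUP_upper)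
  ultimately show ?thesis by blast
qed

lemma expectation_selection:
  assumes "1 \<le> n"
  shows "measure_pmf.expectation (map_pmf (\<lambda>i. (w i, i)) (pmf_of_set {1..n})) f
    = (1 / real n) * (\<Sum>i\<in>{1..n}. f (w i, i) :: real)"
  using assms by (simp add: integral_pmf_of_set)

text \<open>Mixtures show that the attainable pairs of transport cost and value form a convex set in
  the plane. It misses the quadrant of cost below \<open>r\<close> and value above \<open>V\<close>,
  and the slope of a separating line is the multiplier. Since the bound holds for every choice of
  one point per index, \<open>separable_sup\<close> splits it into the numbers
  \<open>\<theta> i\<close>.\<close>

lemma lagrange_multiplier:
  fixes d v :: "'b \<times> nat \<Rightarrow> real"
  assumes "1 \<le> n" "0 < r"
    and base: "\<And>i. i \<in> {1..n} \<Longrightarrow> w0 i \<in> \<Omega> \<and> d (w0 i, i) = 0"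
    and ub: "\<And>R. finite (set_pmf R) \<Longrightarrow> set_pmf R \<subseteq> \<Omega> \<times> {1..n} \<Longrightarrow> map_pmf snd R = pmf_of_set {1..n} \<Longrightarrow>
      measure_pmf.expectation R d \<le> r \<Longrightarrow> measure_pmf.expectation R v \<le> V"
  shows "\<exists>lam\<ge>0. \<exists>\<theta>. (\<forall>i\<in>{1..n}. \<forall>w\<in>\<Omega>. v (w, i) \<le> \<theta> i + lam * d (w, i)) \<and>
    r * lam + (1 / real n) * (\<Sum>i\<in>{1..n}. \<theta> i) \<le> V"
proof -
  define adm where "adm R \<longleftrightarrow> finite (set_pmf R) \<and> set_pmf R \<subseteq> \<Omega> \<times> {1..n} \<and>
    map_pmf snd R = pmf_of_set {1..n}" for R :: "('b \<times> nat) pmf"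
  define A where "A = (\<lambda>R. (measure_pmf.expectation R d, measure_pmf.expectation R v)) ` {R. adm R}"
  define B where "B = {..<r} \<times> {V<..}"
  have sel: "adm (map_pmf (\<lambda>i. (w i, i)) (pmf_of_set {1..n}))" if "\<And>i. i \<in> {1..n} \<Longrightarrow> w i \<in> \<Omega>" for w
    unfolding adm_def using that assms(1) by (auto simp: set_pmf_of_set pmf.map_comp comp_def)
  have in_A: "(measure_pmf.expectation R d, measure_pmf.expectation R v) \<in> A" if "adm R" for R
    using that by (auto simp: A_def)
  have "convex A"
    unfolding convex_def
  proof (intro ballI allI impI)
    fix x y and s t :: real
    assume "x \<in> A" "y \<in> A" and st: "0 \<le> s" "0 \<le> t" "s + t = 1"
    then obtain R1 R2 where R: "adm R1" "adm R2"
      "x = (measure_pmf.expectation R1 d, measure_pmf.expectation R1 v)"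
      "y = (measure_pmf.expectation R2 d, measure_pmf.expectation R2 v)"
      unfolding A_def by auto
    \<comment> \<open>A coin flip between two admissible couplings leaves the index marginal
      uniform, and expectations become convex combinations.\<close>
    define R where "R = bernoulli_pmf s \<bind> (\<lambda>b. if b then R1 else R2)"
    have "set_pmf R \<subseteq> set_pmf R1 \<union> set_pmf R2" by (auto simp: R_def split: if_splits)
    moreover have "map_pmf snd R = pmf_of_set {1..n}"
    proof -
      have "map_pmf snd R = bernoulli_pmf s \<bind> (\<lambda>b. pmf_of_set {1..n})"
        unfolding R_def map_bind_pmf using R(1,2) by (intro bind_pmf_cong) (auto simp: adm_def)
      then show ?thesis by simp
    qed
    ultimately have "adm R"
      using R(1,2) unfolding adm_def by (meson finite_UnI finite_subset le_sup_iff order_trans)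
    moreover have "measure_pmf.expectation R f = s * measure_pmf.expectation R1 f + t * measure_pmf.expectation R2 f"
      for f :: "'b \<times> nat \<Rightarrow> real"
      unfolding R_def using R(1,2) st
      by (subst pmf_expectation_bind[of UNIV]) (auto simp: adm_def UNIV_bool)
    ultimately show "s *\<^sub>R x + t *\<^sub>R y \<in> A"
      unfolding A_def R(3,4) by (intro image_eqI[of _ _ R]) auto
  qed
  moreover have "convex B" unfolding B_def by (intro convex_Times) auto
  moreover have w0: "(0, measure_pmf.expectation (map_pmf (\<lambda>i. (w0 i, i)) (pmf_of_set {1..n})) v) \<in> A"
  proof -
    have "measure_pmf.expectation (map_pmf (\<lambda>i. (w0 i, i)) (pmf_of_set {1..n})) d = 0"
      unfolding expectation_selection[OF assms(1)] using base by simp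
    then show ?thesis using in_A[OF sel, of w0] base by metis
  qed
  moreover have "(0, V + 1) \<in> B" using \<open>0 < r\<close> by (simp add: B_def)
  moreover have "A \<inter> B = {}"
    using ub unfolding A_def B_def adm_def by force
  ultimately obtain a b where ab: "a \<noteq> 0" "\<And>z. z \<in> A \<Longrightarrow> a \<bullet> z \<le> b" "\<And>z. z \<in> B \<Longrightarrow> b \<le> a \<bullet> z"
    using separating_hyperplane_sets[of A B] by blast
  obtain \<alpha> \<beta> where a: "a = (\<alpha>, \<beta>)" by (cases a)
  have B: "b \<le> \<alpha> * (r - s) + \<beta> * (V + t)" if "0 < s" "0 < t" for s t
    using ab(3)[of "(r - s, V + t)"] that by (simp add: B_def a)
  have "\<alpha> \<le> 0"
  proof (rule ccontr)
    assume "\<not> \<alpha> \<le> 0"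
    \<comment> \<open>The quadrant is unbounded towards small cost, so a positive
      \<open>\<alpha>\<close> would push the functional below \<open>b\<close> for this
      \<open>s\<close>. The sign of \<open>\<beta>\<close> follows in the same way from unbounded
      values.\<close>
    define s where "s = (\<bar>\<alpha> * r + \<beta> * (V + 1) - b\<bar> + 1) / \<alpha>"
    have "0 < s" "\<alpha> * s = \<bar>\<alpha> * r + \<beta> * (V + 1) - b\<bar> + 1" using \<open>\<not> \<alpha> \<le> 0\<close> by (simp_all add: s_def)
    with B[of s 1] show False by (simp add: algebra_simps)
  qed
  have "0 \<le> \<beta>"
  proof (rule ccontr)
    assume "\<not> 0 \<le> \<beta>"
    define s where "s = (\<bar>\<alpha> * (r - 1) + \<beta> * V - b\<bar> + 1) / (- \<beta>)"
    have "0 < s" "\<beta> * s = - (\<bar>\<alpha> * (r - 1) + \<beta> * V - b\<bar> + 1)" using \<open>\<not> 0 \<le> \<beta>\<close>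
      by (simp_all add: s_def divide_pos_pos field_simps)
    with B[of 1 s] show False by (simp add: algebra_simps)
  qed
  \<comment> \<open>A vertical line is excluded by the Slater point: leaving all mass at the samples
    has cost zero, which is strictly below \<open>r\<close>.\<close>
  have "\<beta> \<noteq> 0"
  proof
    assume "\<beta> = 0"
    then have "\<alpha> < 0" using \<open>\<alpha> \<le> 0\<close> ab(1) by (auto simp: a zero_prod_def)
    then have "\<alpha> * (r / 2) < 0" using \<open>0 < r\<close> by (simp add: mult_neg_pos)
    moreover have "b \<le> \<alpha> * (r / 2)" using B[of "r / 2" 1] \<open>0 < r\<close> \<open>\<beta> = 0\<close> by simp
    moreover have "0 \<le> b" using ab(2)[OF w0] \<open>\<beta> = 0\<close> by (simp add: a)
    ultimately show False by linarith
  qed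
  then have "0 < \<beta>" using \<open>0 \<le> \<beta>\<close> by simp
  have bb: "b \<le> \<alpha> * r + \<beta> * V"
  proof (rule field_le_epsilon)
    fix e :: real assume "0 < e"
    \<comment> \<open>Approaching the corner \<open>(r, V)\<close> by \<open>s\<close> in both
      coordinates changes the functional by \<open>(\<beta> - \<alpha>) * s = e\<close>.\<close>
    define s where "s = e / (\<beta> - \<alpha>)"
    have "0 < \<beta> - \<alpha>" using \<open>\<alpha> \<le> 0\<close> \<open>0 < \<beta>\<close> by linarith
    then have "0 < s" "(\<beta> - \<alpha>) * s = e" using \<open>0 < e\<close> by (simp_all add: s_def)
    with B[of s s] show "b \<le> \<alpha> * r + \<beta> * V + e" by (simp add: algebra_simps)
  qed
  define lam where "lam = - \<alpha> / \<beta>"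
  have "0 \<le> lam" using \<open>\<alpha> \<le> 0\<close> \<open>0 < \<beta>\<close> by (simp add: lam_def divide_nonpos_pos)
  have A: "snd z - lam * fst z \<le> V - lam * r" if "z \<in> A" for z
  proof -
    have "\<alpha> * fst z + \<beta> * snd z \<le> \<alpha> * r + \<beta> * V"
      using ab(2)[OF that] bb by (cases z) (simp add: a)
    moreover have "\<alpha> = - (\<beta> * lam)" using \<open>0 < \<beta>\<close> by (simp add: lam_def)
    ultimately have "\<beta> * (snd z - lam * fst z) \<le> \<beta> * (V - lam * r)" by (simp add: algebra_simps)
    then show ?thesis using \<open>0 < \<beta>\<close> by simp
  qed
  have "\<exists>\<theta>. (\<forall>i\<in>{1..n}. \<forall>w\<in>\<Omega>. v (w, i) - lam * d (w, i) \<le> \<theta> i) \<and> (\<Sum>i\<in>{1..n}. \<theta> i) \<le> real n * (V - lam * r)"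
  proof (rule separable_sup)
    fix w assume "\<And>i. i \<in> {1..n} \<Longrightarrow> w i \<in> \<Omega>"
    from A[OF in_A[OF sel[OF this]]]
    have "(1 / real n) * (\<Sum>i\<in>{1..n}. v (w i, i)) - lam * ((1 / real n) * (\<Sum>i\<in>{1..n}. d (w i, i))) \<le> V - lam * r"
      unfolding expectation_selection[OF assms(1)] by simp
    then show "(\<Sum>i\<in>{1..n}. v (w i, i) - lam * d (w i, i)) \<le> real n * (V - lam * r)"
      using assms(1) by (simp add: sum_subtractf sum_distrib_left[symmetric] field_simps)
  qed (use base in auto)
  then obtain \<theta> where \<theta>: "\<And>i w. i \<in> {1..n} \<Longrightarrow> w \<in> \<Omega> \<Longrightarrow> v (w, i) - lam * d (w, i) \<le> \<theta> i"
    "(\<Sum>i\<in>{1..n}. \<theta> i) \<le> real n * (V - lam * r)" by blast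
  have "(1 / real n) * (\<Sum>i\<in>{1..n}. \<theta> i) \<le> V - lam * r"
    using \<theta>(2) assms(1) by (simp add: field_simps)
  with \<theta>(1) \<open>0 \<le> lam\<close> show ?thesis
    by (intro exI[of _ lam] conjI exI[of _ \<theta>]) (auto simp: algebra_simps)
qed

lemma finite_convergent_subsequence:
  fixes f :: "nat \<Rightarrow> 'i \<Rightarrow> real"
  assumes "finite I" "\<And>i. i \<in> I \<Longrightarrow> bounded (range (\<lambda>n. f n i))"
  shows "\<exists>r l. strict_mono r \<and> (\<forall>i\<in>I. (\<lambda>n. f (r n) i) \<longlonglongrightarrow> l i)"
  using assms
proof (induction I rule: finite_induct)
  case empty
  show ?case by (auto intro: exI[of _ "\<lambda>n. n"] simp: strict_mono_def)
next
  case (insert j I)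
  then obtain r l where r: "strict_mono r" "\<forall>i\<in>I. (\<lambda>n. f (r n) i) \<longlonglongrightarrow> l i" by auto
  have "bounded (range (\<lambda>n. f (r n) j))"
    using insert.prems[of j] by (auto intro: bounded_subset)
  then obtain m s where s: "strict_mono s" "((\<lambda>n. f (r n) j) \<circ> s) \<longlonglongrightarrow> m"
    using bounded_imp_convergent_subsequence by metis
  have "strict_mono (r \<circ> s)" using r s by (simp add: strict_mono_o)
  moreover have "(\<lambda>n. f ((r \<circ> s) n) i) \<longlonglongrightarrow> (l(j := m)) i" if "i \<in> insert j I" for i
  proof (cases "i = j")
    case True
    then show ?thesis using s by (simp add: comp_def)
  next
    case False
    then show ?thesis
      using LIMSEQ_subseq_LIMSEQ[of "\<lambda>n. f (r n) i" "l i" s] r s that by (auto simp: comp_def)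
  qed
  ultimately show ?case by blast
qed

section \<open>The two duality inequalities\<close>

lemma affine_map_tendsto:
  fixes f :: "'a::euclidean_space \<Rightarrow> 'b::real_normed_vector"
  assumes "affine_map f" "X \<longlonglongrightarrow> a"
  shows "(\<lambda>n. f (X n)) \<longlonglongrightarrow> f a"
proof -
  obtain L b where L: "linear L" "f = (\<lambda>x. L x + b)"
    using assms(1) unfolding affine_map_def by (elim exE conjE) (rule that)
  have "(\<lambda>n. L (X n)) \<longlonglongrightarrow> L a"
    by (rule bounded_linear.tendsto[OF _ assms(2)]) (simp add: L(1) linear_conv_bounded_linear[symmetric])
  then show ?thesis unfolding L(2) by (intro tendsto_intros)
qed

text \<open>Convergence at each fixed dual pair is enough later, since the limiting certificate is
  checked one pair at a time.\<close>

lemma payoff_tendsto: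
  assumes "affine_map (Tmap D)" "affine_map (hmap D)" "X \<longlonglongrightarrow> a" "\<delta> \<longlonglongrightarrow> \<delta>0"
  shows "(\<lambda>n. payoff D (\<delta> n) (X n) w) \<longlonglongrightarrow> payoff D \<delta>0 a w"
proof (cases w)
  case (Pair \<xi> p)
  obtain p1 p2 where p: "p = stack p1 p2" by (rule stack_cases)
  have "linear (\<lambda>A. A *v \<xi>)"
    by (rule linearI) (simp_all add: matrix_vector_mult_add_rdistrib scaleR_matrix_vector_assoc)
  then have "(\<lambda>n. Tmap D (X n) *v \<xi>) \<longlonglongrightarrow> Tmap D a *v \<xi>"
    by (intro bounded_linear.tendsto[of "\<lambda>A. A *v \<xi>", OF _ affine_map_tendsto[OF assms(1,3)]])
      (simp add: linear_conv_bounded_linear)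
  with affine_map_tendsto[OF assms(2,3)] assms(4) show ?thesis
    unfolding Pair p payoff_stack by (intro tendsto_intros)
qed

context
  fixes D :: "('n1::finite, 'n2::finite, 'm::finite, 'k::finite, 'j::finite) dro_data"
  assumes samples: "1 \<le> nsamples D" "\<forall>i\<in>{1..nsamples D}. sample D i \<in> support D"
    and radius: "0 \<le> radius D"
    and expensive: "sufficiently_expensive_recourse D"
begin

lemma sample_dual_pairs:
  obtains p0 where "\<And>i. i \<in> {1..nsamples D} \<Longrightarrow> (sample D i, p0 i) \<in> dual_pairs D"
proof -
  have "\<forall>i\<in>{1..nsamples D}. \<exists>p. (sample D i, p) \<in> dual_pairs D"
    using dual_pairs_exists[OF expensive] samples(2) by blast
  from bchoice[OF this] show thesis using that by blast
qed

section \<open>Strong duality over the Wasserstein ball\<close>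

text \<open>Discrete couplings supported on dual pairs have regularized value at most the worst case
  \<open>V\<close>. For positive radius \<open>lagrange_multiplier\<close> turns this into a
  certificate, which a small perturbation makes strict and hence attainable. For radius zero only
  dual pairs over the samples matter, and \<open>lam\<close> costs nothing.\<close>

lemma cp_objective_le_dro_objective:
  assumes x: "x \<in> decisions D" and reg: "0 < \<delta> \<or> \<delta> = 0 \<and> complete_recourse D"
  shows "cp_objective D \<delta> x \<le> dro_objective D x"
proof -
  let ?I = "{1..nsamples D}"
  have \<delta>: "0 \<le> \<delta>" using reg by auto
  obtain p0 where p0: "\<And>i. i \<in> ?I \<Longrightarrow> (sample D i, p0 i) \<in> dual_pairs D"
    using sample_dual_pairs by blast
  have ne: "dual_pairs D \<noteq> {}" using p0[of 1] samples(1) by auto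
  have worst: "ereal (measure_pmf.expectation R (\<lambda>a. payoff D \<delta> x (fst a))) \<le> worst_case D x"
    if "finite (set_pmf R)" "set_pmf R \<subseteq> dual_pairs D \<times> ?I" "map_pmf snd R = pmf_of_set ?I"
      "measure_pmf.expectation R (\<lambda>a. (norm (fst (fst a) - sample D (snd a)))\<^sup>2) \<le> (radius D)\<^sup>2" for R
  proof (rule pmf_expectation_le_worst_case[OF samples that(1) _ that(3) radius that(4)])
    fix a assume "a \<in> set_pmf R"
    then have "fst a \<in> dual_pairs D" using that(2) by auto
    then have "(fst (fst a), snd (fst a)) \<in> dual_pairs D" by simp
    from dual_pairs_support[OF this] payoff_le_recourse[OF this \<delta>, of x]
    show "fst (fst a) \<in> support D \<and> ereal (payoff D \<delta> x (fst a)) \<le> recourse D x (fst (fst a))" by simp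
  qed
  \<comment> \<open>Choosing dual variables while all mass stays at the samples has zero transport
    cost and is admissible for every radius.\<close>
  have selection: "ereal ((1 / real (nsamples D)) * (\<Sum>i\<in>?I. payoff D \<delta> x (w i))) \<le> worst_case D x"
    if "\<And>i. i \<in> ?I \<Longrightarrow> w i \<in> dual_pairs D \<and> fst (w i) = sample D i" for w
  proof -
    let ?R = "map_pmf (\<lambda>i. (w i, i)) (pmf_of_set ?I)"
    have "ereal (measure_pmf.expectation ?R (\<lambda>a. payoff D \<delta> x (fst a))) \<le> worst_case D x"
    proof (rule worst)
      show "finite (set_pmf ?R)" "set_pmf ?R \<subseteq> dual_pairs D \<times> ?I"
        using samples(1) that by (auto simp: set_pmf_of_set)
      show "map_pmf snd ?R = pmf_of_set ?I" by (simp add: pmf.map_comp comp_def)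
      show "measure_pmf.expectation ?R (\<lambda>a. (norm (fst (fst a) - sample D (snd a)))\<^sup>2) \<le> (radius D)\<^sup>2"
        unfolding expectation_selection[OF samples(1)] using that by simp
    qed
    then show ?thesis unfolding expectation_selection[OF samples(1)] by simp
  qed
  have "worst_case D x \<noteq> - \<infinity>" using selection[of "\<lambda>i. (sample D i, p0 i)"] p0 by auto
  show ?thesis
  proof (cases "worst_case D x")
    case (real V)
    have "cp_objective D \<delta> x \<le> ereal (cost D \<bullet> x + V) + ereal e" if "0 < e" for e
    proof (cases "radius D = 0")
      case False
      then have "0 < (radius D)\<^sup>2" by simp
      have "\<exists>lam\<ge>0. \<exists>\<theta>. (\<forall>i\<in>?I. \<forall>w\<in>dual_pairs D. payoff D \<delta> x (fst (w, i)) \<le>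
          \<theta> i + lam * (norm (fst (fst (w, i)) - sample D (snd (w, i))))\<^sup>2) \<and>
          (radius D)\<^sup>2 * lam + (1 / real (nsamples D)) * (\<Sum>i\<in>?I. \<theta> i) \<le> V"
        by (rule lagrange_multiplier[OF samples(1) \<open>0 < (radius D)\<^sup>2\<close>, where ?w0.0 = "\<lambda>i. (sample D i, p0 i)"])
          (use worst p0 real in auto)
      then obtain lam \<theta> where lam: "0 \<le> lam"
        "\<And>i \<xi> p. i \<in> ?I \<Longrightarrow> (\<xi>, p) \<in> dual_pairs D \<Longrightarrow> payoff D \<delta> x (\<xi>, p) - lam * (norm (\<xi> - sample D i))\<^sup>2 \<le> \<theta> i"
        "(radius D)\<^sup>2 * lam + (1 / real (nsamples D)) * (\<Sum>i\<in>?I. \<theta> i) \<le> V"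
        by (force simp: algebra_simps)
      \<comment> \<open>Raising \<open>lam\<close> and each \<open>\<theta> i\<close> by
        \<open>\<eta>\<close> increases the objective by
        \<open>((radius D)\<^sup>2 + 1) * \<eta> = e\<close>.\<close>
      define \<eta> where "\<eta> = e / ((radius D)\<^sup>2 + 1)"
      have "0 < (radius D)\<^sup>2 + 1" by (simp add: add_nonneg_pos)
      then have \<eta>: "0 < \<eta>" "((radius D)\<^sup>2 + 1) * \<eta> = e" using \<open>0 < e\<close> by (simp_all add: \<eta>_def)
      have "\<exists>s \<psi> \<phi>. copositive (cp_matrix D \<delta> i x (lam + \<eta>) s \<psi> \<phi>) \<and> cp_term D i (lam + \<eta>) s \<psi> \<phi> = \<theta> i + \<eta>"
        if "i \<in> ?I" for i
        using hom_gap_pos[OF reg lam(2)[OF that] ne _ _ _ \<eta>(1)] by (intro copositive_attained) blast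
      then have "cp_objective D \<delta> x \<le> ereal (cost D \<bullet> x + ((radius D)\<^sup>2 * (lam + \<eta>)
          + (1 / real (nsamples D)) * (\<Sum>i\<in>?I. \<theta> i + \<eta>)))"
        using lam(1) \<eta>(1) x by (intro cp_objective_le) auto
      also have "\<dots> \<le> ereal (cost D \<bullet> x + V + e)"
      proof -
        have "(1 / real (nsamples D)) * (\<Sum>i\<in>?I. \<theta> i + \<eta>) = (1 / real (nsamples D)) * (\<Sum>i\<in>?I. \<theta> i) + \<eta>"
          using samples(1) by (simp add: sum.distrib field_simps)
        moreover have "(radius D)\<^sup>2 * (lam + \<eta>) + \<eta> = (radius D)\<^sup>2 * lam + e"
          using \<eta>(2) by (simp add: algebra_simps)
        ultimately show ?thesis using lam(3) by simp
      qed
      finally show ?thesis by simp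
    next
      case True
      have "\<exists>\<theta>. (\<forall>i\<in>?I. \<forall>w\<in>{w \<in> dual_pairs D. fst w = sample D i}. payoff D \<delta> x w \<le> \<theta> i) \<and>
          (\<Sum>i\<in>?I. \<theta> i) \<le> real (nsamples D) * V"
      proof (rule separable_sup)
        show "{w \<in> dual_pairs D. fst w = sample D i} \<noteq> {}" if "i \<in> ?I" for i using p0[OF that] by force
        fix w assume "\<And>i. i \<in> ?I \<Longrightarrow> w i \<in> {w \<in> dual_pairs D. fst w = sample D i}"
        then show "(\<Sum>i\<in>?I. payoff D \<delta> x (w i)) \<le> real (nsamples D) * V"
          using selection[of w] samples(1) unfolding real by (simp add: field_simps)
      qed simp
      then obtain \<theta> where \<theta>: "\<And>i p. i \<in> ?I \<Longrightarrow> (sample D i, p) \<in> dual_pairs D \<Longrightarrow> payoff D \<delta> x (sample D i, p) \<le> \<theta> i"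
        "(\<Sum>i\<in>?I. \<theta> i) \<le> real (nsamples D) * V" by force
      have "\<exists>lam0\<ge>0. \<forall>lam\<ge>lam0. \<exists>s \<psi> \<phi>. copositive (cp_matrix D \<delta> i x lam s \<psi> \<phi>) \<and> cp_term D i lam s \<psi> \<phi> = \<theta> i + e"
        if "i \<in> ?I" for i
      proof (rule copositive_attained_at_sample, rule hom_gap_pos_at_center[OF reg])
        show "payoff D \<delta> x (sample D i, p) < \<theta> i + e" if "(sample D i, p) \<in> dual_pairs D" for p
          using \<theta>(1)[OF \<open>i \<in> ?I\<close> that] \<open>0 < e\<close> by simp
      qed
      then obtain lam0 where lam0: "\<And>i. i \<in> ?I \<Longrightarrow> 0 \<le> lam0 i \<and> (\<forall>lam\<ge>lam0 i.
          \<exists>s \<psi> \<phi>. copositive (cp_matrix D \<delta> i x lam s \<psi> \<phi>) \<and> cp_term D i lam s \<psi> \<phi> = \<theta> i + e)"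
        by metis
      \<comment> \<open>The thresholds are nonnegative, so their sum is a common multiplier that is
        admissible for every sample.\<close>
      define lam where "lam = (\<Sum>i\<in>?I. lam0 i)"
      have "lam0 i \<le> lam" if "i \<in> ?I" for i
        unfolding lam_def using lam0 by (intro member_le_sum that) auto
      then have "cp_objective D \<delta> x \<le> ereal (cost D \<bullet> x + ((radius D)\<^sup>2 * lam
          + (1 / real (nsamples D)) * (\<Sum>i\<in>?I. \<theta> i + e)))"
        using lam0 x by (intro cp_objective_le) (auto simp: lam_def intro!: sum_nonneg)
      also have "\<dots> \<le> ereal (cost D \<bullet> x + V + e)"
        using \<theta>(2) samples(1) by (simp add: True sum.distrib field_simps)
      finally show ?thesis by simp
    qed
    then have "cp_objective D \<delta> x \<le> ereal (cost D \<bullet> x + V)" by (rule ereal_le_epsilon2)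
    then show ?thesis by (simp add: dro_objective_def real)
  next
    case PInf
    then show ?thesis by (simp add: dro_objective_def)
  next
    case MInf
    with \<open>worst_case D x \<noteq> - \<infinity>\<close> show ?thesis by simp
  qed
qed

section \<open>Upper bounds on the robust objective from certificates\<close>

text \<open>Linear programming duality turns the bound on dual pairs into a pointwise bound on the
  recourse function, which is then integrated over the ambiguity set.\<close>

lemma dro_objective_le:
  assumes "0 \<le> lam"
    and "\<And>i \<xi> p. i \<in> {1..nsamples D} \<Longrightarrow> (\<xi>, p) \<in> dual_pairs D \<Longrightarrow>
      payoff D 0 x (\<xi>, p) \<le> \<theta> i + lam * (norm (\<xi> - sample D i))\<^sup>2"
  shows "dro_objective D x \<le>
    ereal (cost D \<bullet> x + ((radius D)\<^sup>2 * lam + (1 / real (nsamples D)) * (\<Sum>i\<in>{1..nsamples D}. \<theta> i)))"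
proof -
  have "worst_case D x \<le> ereal ((radius D)\<^sup>2 * lam + (1 / real (nsamples D)) * (\<Sum>i\<in>{1..nsamples D}. \<theta> i))"
    unfolding worst_case_def
  proof (rule SUP_least)
    fix P assume P: "P \<in> ambiguity_set D"
    then have "sets P = sets (restrict_space borel (support D))"
      by (auto simp: ambiguity_set_def distributions2_def)
    then have "space P = support D"
      using sets_eq_imp_space_eq[of P] by (simp add: space_restrict_space)
    then have "AE \<xi> in P. \<forall>i\<in>{1..nsamples D}. recourse D x \<xi> \<le> ereal (\<theta> i + lam * (norm (\<xi> - sample D i))\<^sup>2)"
      using assms(2) by (intro AE_I2 ballI recourse_le[OF expensive]) auto
    then show "ext_expectation P (recourse D x)
        \<le> ereal ((radius D)\<^sup>2 * lam + (1 / real (nsamples D)) * (\<Sum>i\<in>{1..nsamples D}. \<theta> i))"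
      by (rule ext_expectation_le_dual[OF samples P assms(1)])
  qed
  then have "ereal (cost D \<bullet> x) + worst_case D x
      \<le> ereal (cost D \<bullet> x) + ereal ((radius D)\<^sup>2 * lam + (1 / real (nsamples D)) * (\<Sum>i\<in>{1..nsamples D}. \<theta> i))"
    by (rule add_left_mono)
  then show ?thesis by (simp add: dro_objective_def)
qed

text \<open>Every admissible distribution is concentrated on the samples. A multiplier that
  dominates all slopes of \<open>\<theta>\<close> between distinct sample points makes the bounds at
  the samples compatible, and its weight in the objective is zero.\<close>

lemma dro_objective_le_radius_zero:
  assumes "radius D = 0"
    and ub: "\<And>i p. i \<in> {1..nsamples D} \<Longrightarrow> (sample D i, p) \<in> dual_pairs D \<Longrightarrow>
      payoff D 0 x (sample D i, p) \<le> \<theta> i"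
  shows "dro_objective D x \<le>
    ereal (cost D \<bullet> x + (1 / real (nsamples D)) * (\<Sum>i\<in>{1..nsamples D}. \<theta> i))"
proof -
  let ?I = "{1..nsamples D}"
  \<comment> \<open>For coinciding samples the quotient is zero by the convention for division; that
    case is treated separately below, where the bound of index \<open>i\<close> applies
    directly.\<close>
  define q where "q i j = \<bar>\<theta> j - \<theta> i\<bar> / (norm (sample D j - sample D i))\<^sup>2" for i j
  define lam where "lam = (\<Sum>i\<in>?I. \<Sum>j\<in>?I. q i j)"
  have q: "0 \<le> q i j" for i j by (simp add: q_def)
  have "0 \<le> lam" unfolding lam_def by (intro sum_nonneg q)
  have q_le: "q i j \<le> lam" if "i \<in> ?I" "j \<in> ?I" for i j
  proof -
    have "q i j \<le> (\<Sum>j\<in>?I. q i j)" using that q by (intro member_le_sum) auto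
    also have "\<dots> \<le> lam" unfolding lam_def
      using that q by (intro member_le_sum[of i ?I "\<lambda>i. \<Sum>j\<in>?I. q i j"]) (auto intro: sum_nonneg)
    finally show ?thesis .
  qed
  have bound: "recourse D x (sample D j) \<le> ereal (\<theta> i + lam * (norm (sample D j - sample D i))\<^sup>2)"
    if ij: "i \<in> ?I" "j \<in> ?I" for i j
  proof (cases "sample D j = sample D i")
    case True
    then show ?thesis using ub[OF ij(1)] samples(2) ij by (auto intro!: recourse_le[OF expensive])
  next
    case False
    then have "\<theta> j - \<theta> i \<le> q i j * (norm (sample D j - sample D i))\<^sup>2" by (simp add: q_def)
    also have "\<dots> \<le> lam * (norm (sample D j - sample D i))\<^sup>2"
      using q_le[OF ij] by (simp add: mult_right_mono)
    finally have "\<theta> j \<le> \<theta> i + lam * (norm (sample D j - sample D i))\<^sup>2" by simp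
    with ub[OF ij(2)] show ?thesis
      using samples(2) ij by (intro recourse_le[OF expensive]) force+
  qed
  have "worst_case D x \<le> ereal ((1 / real (nsamples D)) * (\<Sum>i\<in>?I. \<theta> i))"
    unfolding worst_case_def
  proof (rule SUP_least)
    fix P assume P: "P \<in> ambiguity_set D"
    have "AE \<xi> in P. \<forall>i\<in>?I. recourse D x \<xi> \<le> ereal (\<theta> i + lam * (norm (\<xi> - sample D i))\<^sup>2)"
      using AE_sample_of_radius_zero[OF samples P assms(1)]
      by (rule eventually_mono) (use bound in blast)
    from ext_expectation_le_dual[OF samples P \<open>0 \<le> lam\<close> this]
    show "ext_expectation P (recourse D x) \<le> ereal ((1 / real (nsamples D)) * (\<Sum>i\<in>?I. \<theta> i))"
      by (simp add: assms(1))
  qed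
  then have "ereal (cost D \<bullet> x) + worst_case D x
      \<le> ereal (cost D \<bullet> x) + ereal ((1 / real (nsamples D)) * (\<Sum>i\<in>?I. \<theta> i))"
    by (rule add_left_mono)
  then show ?thesis by (simp add: dro_objective_def)
qed

lemma dro_objective_le_cp_objective: "x \<in> decisions D \<Longrightarrow> dro_objective D x \<le> cp_objective D 0 x"
  unfolding cp_objective_def
proof (rule Inf_greatest, clarify)
  fix lam s \<psi> \<phi> assume "cp_feasible D 0 x lam s \<psi> \<phi>"
  from cp_feasible_bounds[OF this] obtain \<theta> where \<theta>: "0 \<le> lam" "\<forall>i\<in>{1..nsamples D}. \<forall>\<xi> p. (\<xi>, p) \<in> dual_pairs D \<longrightarrow>
      payoff D 0 x (\<xi>, p) \<le> \<theta> i + lam * (norm (\<xi> - sample D i))\<^sup>2"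
    and cost: "cp_cost D x lam s \<psi> \<phi> =
      cost D \<bullet> x + ((radius D)\<^sup>2 * lam + (1 / real (nsamples D)) * (\<Sum>i\<in>{1..nsamples D}. \<theta> i))"
    by (elim exE conjE) (rule that)
  show "dro_objective D x \<le> ereal (cp_cost D x lam s \<psi> \<phi>)"
    unfolding cost by (rule dro_objective_le[where lam = lam and \<theta> = \<theta>]) (use \<theta> in blast)+
qed

section \<open>The limit of vanishing regularization\<close>

text \<open>Certificates of cost below \<open>w\<close> have bounded \<open>\<theta>\<close>, and
  for positive radius also bounded \<open>lam\<close>. A subsequence converges, and the inequality
  at each dual pair passes to the limit. For radius zero \<open>lam\<close> may diverge, so only the
  inequalities at the samples, which do not contain it, are kept.\<close>

lemma dro_objective_le_limit:
  assumes affine: "affine_map (Tmap D)" "affine_map (hmap D)"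
    and X: "X \<longlonglongrightarrow> x" and \<delta>: "\<delta> \<longlonglongrightarrow> 0" and less: "\<And>n. cp_objective D (\<delta> n) (X n) < ereal w"
  shows "dro_objective D x \<le> ereal w"
proof -
  let ?I = "{1..nsamples D}" and ?N = "real (nsamples D)"
  have N: "0 < ?N" using samples(1) by simp
  have "\<exists>lam \<theta>. 0 \<le> lam \<and> (\<forall>i\<in>?I. \<forall>\<xi> p. (\<xi>, p) \<in> dual_pairs D \<longrightarrow>
      payoff D (\<delta> n) (X n) (\<xi>, p) \<le> \<theta> i + lam * (norm (\<xi> - sample D i))\<^sup>2) \<and>
      cost D \<bullet> X n + ((radius D)\<^sup>2 * lam + (1 / ?N) * (\<Sum>i\<in>?I. \<theta> i)) < w" for n
  proof -
    obtain lam s \<psi> \<phi> where f: "cp_feasible D (\<delta> n) (X n) lam s \<psi> \<phi>" "cp_cost D (X n) lam s \<psi> \<phi> < w"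
      using less[of n] unfolding cp_objective_def Inf_less_iff by auto
    with cp_feasible_bounds[OF f(1)] show ?thesis by metis
  qed
  then obtain lam \<theta> where lam: "\<And>n. 0 \<le> lam n"
    and ub: "\<And>n i \<xi> p. i \<in> ?I \<Longrightarrow> (\<xi>, p) \<in> dual_pairs D \<Longrightarrow>
      payoff D (\<delta> n) (X n) (\<xi>, p) \<le> \<theta> n i + lam n * (norm (\<xi> - sample D i))\<^sup>2"
    and cost: "\<And>n. cost D \<bullet> X n + ((radius D)\<^sup>2 * lam n + (1 / ?N) * (\<Sum>i\<in>?I. \<theta> n i)) < w"
    by metis
  have pay: "(\<lambda>n. payoff D (\<delta> n) (X n) z) \<longlonglongrightarrow> payoff D 0 x z" for z
    by (rule payoff_tendsto[OF affine X \<delta>])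
  obtain p0 where p0: "\<And>i. i \<in> ?I \<Longrightarrow> (sample D i, p0 i) \<in> dual_pairs D"
    using sample_dual_pairs by blast
  obtain C where C: "\<And>n. \<bar>cost D \<bullet> X n\<bar> \<le> C"
    using convergent_imp_Bseq[OF convergentI, OF tendsto_inner[OF tendsto_const X, of "cost D"]]
    by (auto simp: Bseq_def)
  \<comment> \<open>At the sample itself the transport term vanishes, so \<open>\<theta> n i\<close>
    lies above a convergent, hence bounded, sequence of payoffs.\<close>
  have "\<exists>l. \<forall>n. - l \<le> \<theta> n i \<and> 0 \<le> l" if "i \<in> ?I" for i
  proof -
    obtain l where l: "\<And>n. \<bar>payoff D (\<delta> n) (X n) (sample D i, p0 i)\<bar> \<le> l"
      using convergent_imp_Bseq[OF convergentI, OF pay[of "(sample D i, p0 i)"]] by (auto simp: Bseq_def)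
    have "- l \<le> \<theta> n i \<and> 0 \<le> l" for n
      using ub[OF that p0[OF that], of n] l[of n] by simp arith
    then show ?thesis by blast
  qed
  then obtain l where l: "\<And>i n. i \<in> ?I \<Longrightarrow> - l i \<le> \<theta> n i \<and> 0 \<le> l i" by metis
  define L where "L = (\<Sum>i\<in>?I. l i)"
  \<comment> \<open>Partial sums are included because the upper bound on a single
    \<open>\<theta> n i\<close> comes from the total minus the remaining terms.\<close>
  have L: "- L \<le> (\<Sum>i\<in>J. \<theta> n i)" if "J \<subseteq> ?I" for J n
  proof -
    have "(\<Sum>i\<in>J. l i) \<le> L" unfolding L_def using that l by (intro sum_mono2) auto
    moreover have "(\<Sum>i\<in>J. - l i) \<le> (\<Sum>i\<in>J. \<theta> n i)" using that l by (intro sum_mono) auto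
    ultimately show ?thesis by (simp add: sum_negf)
  qed
  have sum_ub: "(\<Sum>i\<in>?I. \<theta> n i) + ?N * ((radius D)\<^sup>2 * lam n) \<le> ?N * (w + C)" for n
  proof -
    have "(1 / ?N) * (\<Sum>i\<in>?I. \<theta> n i) + (radius D)\<^sup>2 * lam n \<le> w + C"
      using cost[of n] C[of n] by linarith
    then show ?thesis using N by (simp add: field_simps)
  qed
  have \<theta>_bounded: "bounded (range (\<lambda>n. \<theta> n i))" if "i \<in> ?I" for i
  proof -
    have "\<bar>\<theta> n i\<bar> \<le> l i + \<bar>?N * (w + C) + L\<bar>" for n
    proof -
      have "(\<Sum>i\<in>?I. \<theta> n i) = \<theta> n i + (\<Sum>i\<in>?I - {i}. \<theta> n i)" using that by (intro sum.remove) auto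
      moreover have "0 \<le> ?N * ((radius D)\<^sup>2 * lam n)" using lam by simp
      ultimately show ?thesis using sum_ub[of n] L[of "?I - {i}" n] l[OF that, of n] by auto
    qed
    then show ?thesis by (auto simp: bounded_iff)
  qed
  show ?thesis
  proof (cases "radius D = 0")
    case True
    obtain r \<theta>' where r: "strict_mono r" and "\<forall>i\<in>?I. (\<lambda>n. \<theta> (r n) i) \<longlonglongrightarrow> \<theta>' i"
      using finite_convergent_subsequence[of ?I \<theta>, OF finite_atLeastAtMost \<theta>_bounded] by blast
    then have \<theta>': "(\<lambda>n. \<theta> (r n) i) \<longlonglongrightarrow> \<theta>' i" if "i \<in> ?I" for i using that by blast
    have "dro_objective D x \<le> ereal (cost D \<bullet> x + (1 / ?N) * (\<Sum>i\<in>?I. \<theta>' i))"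
    proof (rule dro_objective_le_radius_zero[OF True])
      fix i p assume i: "i \<in> ?I" "(sample D i, p) \<in> dual_pairs D"
      show "payoff D 0 x (sample D i, p) \<le> \<theta>' i"
        using LIMSEQ_subseq_LIMSEQ[OF pay r, unfolded comp_def] \<theta>'[OF i(1)]
        by (rule LIMSEQ_le) (use ub[OF i] in auto)
    qed
    also have "cost D \<bullet> x + (1 / ?N) * (\<Sum>i\<in>?I. \<theta>' i) \<le> w"
    proof (rule LIMSEQ_le_const2)
      show "(\<lambda>n. cost D \<bullet> X (r n) + (1 / ?N) * (\<Sum>i\<in>?I. \<theta> (r n) i)) \<longlonglongrightarrow> cost D \<bullet> x + (1 / ?N) * (\<Sum>i\<in>?I. \<theta>' i)"
        using LIMSEQ_subseq_LIMSEQ[OF X r, unfolded comp_def] by (intro tendsto_intros \<theta>')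
      show "\<exists>N. \<forall>n\<ge>N. cost D \<bullet> X (r n) + (1 / ?N) * (\<Sum>i\<in>?I. \<theta> (r n) i) \<le> w"
        using cost True by (auto intro!: less_imp_le)
    qed
    finally show ?thesis by simp
  next
    case False
    \<comment> \<open>Samples are numbered from 1, so index 0 is free for the multiplier and one
      extraction handles all sequences together.\<close>
    define F where "F n i = (if i = 0 then lam n else \<theta> n i)" for n i
    have "bounded (range (\<lambda>n. F n i))" if "i \<in> insert 0 ?I" for i
    proof (cases "i = 0")
      case True
      have "\<bar>lam n\<bar> \<le> (?N * (w + C) + L) / (?N * (radius D)\<^sup>2)" for n
        using sum_ub[of n] L[of ?I n] lam[of n] N False by (simp add: field_simps)
      then show ?thesis using True by (auto simp: bounded_iff F_def)
    qed (use that \<theta>_bounded in \<open>auto simp: F_def\<close>)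
    then obtain r G where r: "strict_mono r" and "\<forall>i\<in>insert 0 ?I. (\<lambda>n. F (r n) i) \<longlonglongrightarrow> G i"
      using finite_convergent_subsequence[of "insert 0 ?I" F] by blast
    then have G: "(\<lambda>n. F (r n) i) \<longlonglongrightarrow> G i" if "i \<in> insert 0 ?I" for i using that by blast
    have lim_lam: "(\<lambda>n. lam (r n)) \<longlonglongrightarrow> G 0" using G[of 0] by (simp add: F_def)
    have lim_\<theta>: "(\<lambda>n. \<theta> (r n) i) \<longlonglongrightarrow> G i" if "i \<in> ?I" for i using G[of i] that by (simp add: F_def)
    have "dro_objective D x \<le> ereal (cost D \<bullet> x + ((radius D)\<^sup>2 * G 0 + (1 / ?N) * (\<Sum>i\<in>?I. G i)))"
    proof (rule dro_objective_le)
      show "0 \<le> G 0" by (rule LIMSEQ_le_const[OF lim_lam]) (use lam in auto)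
      fix i \<xi> p assume i: "i \<in> ?I" "(\<xi>, p) \<in> dual_pairs D"
      have "(\<lambda>n. \<theta> (r n) i + lam (r n) * (norm (\<xi> - sample D i))\<^sup>2) \<longlonglongrightarrow> G i + G 0 * (norm (\<xi> - sample D i))\<^sup>2"
        by (intro tendsto_intros lim_lam lim_\<theta> i)
      with LIMSEQ_subseq_LIMSEQ[OF pay r, unfolded comp_def]
      show "payoff D 0 x (\<xi>, p) \<le> G i + G 0 * (norm (\<xi> - sample D i))\<^sup>2"
        by (rule LIMSEQ_le) (use ub[OF i] in auto)
    qed
    also have "cost D \<bullet> x + ((radius D)\<^sup>2 * G 0 + (1 / ?N) * (\<Sum>i\<in>?I. G i)) \<le> w"
    proof (rule LIMSEQ_le_const2)
      show "(\<lambda>n. cost D \<bullet> X (r n) + ((radius D)\<^sup>2 * lam (r n) + (1 / ?N) * (\<Sum>i\<in>?I. \<theta> (r n) i)))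
          \<longlonglongrightarrow> cost D \<bullet> x + ((radius D)\<^sup>2 * G 0 + (1 / ?N) * (\<Sum>i\<in>?I. G i))"
        using LIMSEQ_subseq_LIMSEQ[OF X r, unfolded comp_def] by (intro tendsto_intros lim_lam lim_\<theta>)
      show "\<exists>N. \<forall>n\<ge>N. cost D \<bullet> X (r n) + ((radius D)\<^sup>2 * lam (r n) + (1 / ?N) * (\<Sum>i\<in>?I. \<theta> (r n) i)) \<le> w"
        using cost by (auto intro!: less_imp_le)
    qed
    finally show ?thesis by simp
  qed
qed

end

section \<open>Assembly of the four statements\<close>

theorem theorem5:
  fixes D :: "('n1::finite, 'n2::finite, 'm::finite, 'k::finite, 'j::finite) dro_data"
  assumes "affine_map (Tmap D)" and "affine_map (hmap D)"
    and "support D \<noteq> {}"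
    and "1 \<le> nsamples D" and "\<forall>i\<in>{1..nsamples D}. sample D i \<in> support D"
    and "0 \<le> radius D"
    and "sufficiently_expensive_recourse D"
  shows "(complete_recourse D \<longrightarrow> cp_equivalent_dro D 0) \<and>
    (\<not> complete_recourse D \<longrightarrow> dro_value D \<le> cp_value D 0) \<and>
    (\<forall>\<delta>>0. cp_value D \<delta> \<le> dro_value D) \<and>
    (compact (decisions D) \<longrightarrow>
      ((\<lambda>\<delta>. cp_value D \<delta>) \<longlongrightarrow> dro_value D) (at_right 0) \<and>
      (\<forall>(\<delta> :: nat \<Rightarrow> real) x xstar.
         (\<forall>n. 0 < \<delta> n) \<and> \<delta> \<longlonglongrightarrow> 0 \<and> (\<forall>n. cp_minimizer D (\<delta> n) (x n)) \<and>
         cluster_point x xstar \<longrightarrow> dro_minimizer D xstar))"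
proof (intro conjI impI allI)
  note lower = cp_objective_le_dro_objective[OF assms(4-7)]
  note upper = dro_objective_le_cp_objective[OF assms(4-7)]
  note limit = dro_objective_le_limit[OF assms(4-7) assms(1,2)]
  show "cp_equivalent_dro D 0" if "complete_recourse D"
    unfolding cp_equivalent_dro_def using lower upper that by (blast intro: antisym)
  show "dro_value D \<le> cp_value D 0"
    unfolding dro_value_def cp_value_eq_INF using upper by (auto intro: INF_mono)
  have value_le: "cp_value D \<delta> \<le> dro_value D" if "0 < \<delta>" for \<delta>
    unfolding dro_value_def cp_value_eq_INF using lower that by (auto intro: INF_mono)
  show "cp_value D \<delta> \<le> dro_value D" if "0 < \<delta>" for \<delta> by (rule value_le[OF that])
  assume compact: "compact (decisions D)"
  show "((\<lambda>\<delta>. cp_value D \<delta>) \<longlongrightarrow> dro_value D) (at_right 0)"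
  proof (rule order_tendstoI)
    fix a assume "dro_value D < a"
    then have "cp_value D \<delta> < a" if "0 < \<delta>" for \<delta>
      using value_le[OF that] by (rule le_less_trans[rotated])
    then show "\<forall>\<^sub>F \<delta> in at_right 0. cp_value D \<delta> < a"
      by (intro eventually_mono[OF eventually_at_right_less])
  next
    fix a assume "a < dro_value D"
    then obtain b where b: "a < ereal b" "ereal b < dro_value D" using ereal_dense2 by blast
    \<comment> \<open>Otherwise there are parameters tending to zero with values at most
      \<open>a\<close>. Nearly optimal decisions for them cluster at some \<open>l\<close> in the
      compact set, and the limit lemma bounds the robust objective at \<open>l\<close> by
      \<open>b\<close>, below the optimal value.\<close>
    show "\<forall>\<^sub>F \<delta> in at_right 0. a < cp_value D \<delta>"
    proof (rule ccontr)
      assume not: "\<not> ?thesis"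
      have "\<exists>\<delta>>0. \<delta> < inverse (real (Suc n)) \<and> cp_value D \<delta> \<le> a" for n
      proof (rule ccontr)
        assume "\<not> ?thesis"
        then have "\<forall>\<delta>>0. \<delta> < inverse (real (Suc n)) \<longrightarrow> a < cp_value D \<delta>" by (metis not_le)
        moreover have "0 < inverse (real (Suc n))" by simp
        ultimately have "\<forall>\<^sub>F \<delta> in at_right 0. a < cp_value D \<delta>"
          unfolding eventually_at_right_field by (intro exI[of _ "inverse (real (Suc n))"] conjI)
        with not show False by simp
      qed
      then obtain \<delta> where \<delta>: "\<And>n. 0 < \<delta> n" "\<And>n. \<delta> n < inverse (real (Suc n))" "\<And>n. cp_value D (\<delta> n) \<le> a"
        by metis
      have "\<delta> \<longlonglongrightarrow> 0"
        by (rule tendsto_sandwich[OF _ _ tendsto_const LIMSEQ_inverse_real_of_nat])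
          (intro always_eventually allI less_imp_le \<delta>)+
      have "\<exists>x\<in>decisions D. cp_objective D (\<delta> n) x < ereal b" for n
        using le_less_trans[OF \<delta>(3) b(1), of n] unfolding cp_value_eq_INF INF_less_iff .
      then obtain x where x: "\<And>n. x n \<in> decisions D" "\<And>n. cp_objective D (\<delta> n) (x n) < ereal b"
        by metis
      obtain l r where r: "l \<in> decisions D" "strict_mono r" "(x \<circ> r) \<longlonglongrightarrow> l"
        using compact_imp_seq_compact[OF compact] x(1) unfolding seq_compact_def by blast
      have "dro_objective D l \<le> ereal b"
        using limit[OF r(3) LIMSEQ_subseq_LIMSEQ[OF \<open>\<delta> \<longlonglongrightarrow> 0\<close> r(2)]] x(2) by simp
      moreover have "dro_value D \<le> dro_objective D l"
        unfolding dro_value_def by (rule INF_lower[OF r(1)])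
      ultimately show False using b(2) by (meson leD le_less_trans order_trans)
    qed
  qed
  fix \<delta> :: "nat \<Rightarrow> real" and x xstar
  assume *: "(\<forall>n. 0 < \<delta> n) \<and> \<delta> \<longlonglongrightarrow> 0 \<and> (\<forall>n. cp_minimizer D (\<delta> n) (x n)) \<and> cluster_point x xstar"
  then obtain r where r: "strict_mono r" "(x \<circ> r) \<longlonglongrightarrow> xstar" unfolding cluster_point_def by blast
  have min: "x n \<in> decisions D" "y \<in> decisions D \<Longrightarrow> cp_objective D (\<delta> n) (x n) \<le> cp_objective D (\<delta> n) y" for n y
    using * by (auto simp: cp_minimizer_def is_arg_min_def not_less)
  have "xstar \<in> decisions D"
    using closed_sequentially[OF compact_imp_closed[OF compact] _ r(2)] min(1) by simp
  moreover have "\<not> dro_objective D y < dro_objective D xstar" if y: "y \<in> decisions D" for y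
  proof
    assume "dro_objective D y < dro_objective D xstar"
    \<comment> \<open>The level \<open>b\<close> lies above the copositive objective of
      \<open>y\<close> for every \<open>\<delta> n\<close>, hence above that of the minimizers
      \<open>x n\<close>. The limit lemma then puts the robust objective of \<open>xstar\<close> at
      or below \<open>b\<close>.\<close>
    then obtain b where b: "dro_objective D y < ereal b" "ereal b < dro_objective D xstar"
      using ereal_dense2 by blast
    have "cp_objective D (\<delta> n) (x n) < ereal b" for n
    proof -
      have "cp_objective D (\<delta> n) (x n) \<le> cp_objective D (\<delta> n) y" by (rule min(2)[OF y])
      also have "\<dots> \<le> dro_objective D y" using * by (intro lower y) simp
      finally show ?thesis using b(1) by (rule le_less_trans)
    qed
    then have "dro_objective D xstar \<le> ereal b"
      using limit[OF r(2) LIMSEQ_subseq_LIMSEQ[OF _ r(1)], of \<delta> b] * by simp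
    with b(2) show False by simp
  qed
  ultimately show "dro_minimizer D xstar" by (simp add: dro_minimizer_def is_arg_min_def)
qed

end
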